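(* Let $k>1$ be an integer which is not a perfect square, and let $(x,y,z)$ be a solution in positive integers of $x^2+(2k-1)^y=k^z$ with $y\in\{3,5\}$. Let $(u_1,v_1)$ be the least solution of the Pell equation $u^2-kv^2=1$ (i.e. the positive integer solution minimizing $u+v\sqrt{k}$). Then $z$ is odd, and there exist positive integers $X_1,Y_1,Z_1$, a positive integer $t$, a sign $\lambda\in\{1,-1\}$, and integers $u,v$ with $u^2-kv^2=1$, such that $$X_1^2-kY_1^2=(-(2k-1))^{Z_1},\quad \gcd(X_1,Y_1)=1,\quad Z_1\mid h(4k),$$ $$1<\left\lvert \frac{X_1+Y_1\sqrt{k}}{X_1-Y_1\sqrt{k}}\right\rvert<u_1+v_1\sqrt{k},$$ and $$y=Z_1t,\qquad x+k^{(z-1)/2}\sqrt{k}=(X_1+\lambda Y_1\sqrt{k})^t(u+v\sqrt{k}).$$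
   Context: $h(4k)$ denotes the class number of binary quadratic primitive forms with discriminant $4k$. *)

theory Defs
  imports Complex_Main "HOL-Computational_Algebra.Nth_Powers"
begin

text \<open>The triple \<open>(a, b, c)\<close> stands for the form \<open>a X^2 + b X Y + c Y^2\<close>.\<close>
type_synonym bqf = "int \<times> int \<times> int"

fun bqf_eval :: "bqf \<Rightarrow> int \<Rightarrow> int \<Rightarrow> int" where
  "bqf_eval (a, b, c) X Y = a * X^2 + b * X * Y + c * Y^2"

fun bqf_disc :: "bqf \<Rightarrow> int" where
  "bqf_disc (a, b, c) = b^2 - 4 * a * c"

fun bqf_primitive :: "bqf \<Rightarrow> bool" where
  "bqf_primitive (a, b, c) \<longleftrightarrow> gcd a (gcd b c) = 1"

definition primitive_forms :: "int \<Rightarrow> bqf set" where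
  "primitive_forms D = {f. bqf_primitive f \<and> bqf_disc f = D}"

text \<open>Proper equivalence: only substitutions of determinant \<open>+1\<close> are allowed, as is
  needed for the classes to form a group under composition.\<close>
definition bqf_equiv :: "int \<Rightarrow> bqf rel" where
  "bqf_equiv D = {(f, g). f \<in> primitive_forms D \<and> g \<in> primitive_forms D \<and>
     (\<exists>p q r s :: int. p * s - q * r = 1 \<and>
        (\<forall>X Y. bqf_eval g X Y = bqf_eval f (p * X + q * Y) (r * X + s * Y)))}"

text \<open>Meant for positive non-square discriminants (where the number of classes is finite):
  for \<open>D < 0\<close> negative definite forms would be counted too.\<close>
definition class_number :: "int \<Rightarrow> nat" where
  "class_number D = card (primitive_forms D // bqf_equiv D)"

definition least_pell_solution :: "int \<Rightarrow> int \<Rightarrow> int \<Rightarrow> bool" where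
  "least_pell_solution k u1 v1 \<longleftrightarrow>
     u1 > 0 \<and> v1 > 0 \<and> u1^2 - k * v1^2 = 1 \<and>
     (\<forall>u v :: int. u > 0 \<and> v > 0 \<and> u^2 - k * v^2 = 1 \<longrightarrow>
        real_of_int u1 + real_of_int v1 * sqrt (real_of_int k)
          \<le> real_of_int u + real_of_int v * sqrt (real_of_int k))"

end

theory Submission
  imports Defs "HOL-Computational_Algebra.Primes"
begin

text \<open>If \<open>z = 2 m\<close>, then \<open>k ^ (2 m) - (2 k - 1) ^ y\<close> is a square just below \<open>(k ^ m)\<^sup>2\<close>, which bounds
  \<open>m\<close>; for each remaining \<open>m\<close> Runge's method leaves finitely many \<open>k\<close>, which are sieved out.

  If \<open>z\<close> is odd, put \<open>K = k ^ ((z - 1) div 2)\<close> and \<open>N = - (2 k - 1)\<close>; then \<open>x + K * sqrt k\<close> has norm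
  \<open>N ^ y\<close> and determines a root \<open>\<beta>\<close> of \<open>\<beta>\<^sup>2 = k\<close> modulo \<open>N ^ y\<close>. Composition with the class of the form
  \<open>(N, 2 \<beta>, (\<beta>\<^sup>2 - k) div N)\<close> is a permutation of the classes of discriminant \<open>4 k\<close> whose \<open>y\<close>-th power is the identity.
  As \<open>y\<close> is prime, either it has no fixed point and \<open>y\<close> divides the class number (\<open>Z1 = y\<close>), or it
  fixes a class, which yields an element of norm \<open>N\<close> whose \<open>y\<close>-th power is associated to \<open>x + K * sqrt k\<close>
  (\<open>Z1 = 1\<close>). Infinitely many classes would give class number 0, which \<open>y\<close> divides as well.\<close>

section \<open>Even exponents\<close>

text \<open>Moduli with their quadratic residues, 0 included. Together they exclude every small
  \<open>k\<close> that the size arguments leave over; \<open>square_residues_complete\<close>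
  checks that no residue is missing.\<close>

definition square_residues :: "(int \<times> int list) list" where
  "square_residues = [
    (31, [0, 1, 2, 4, 5, 7, 8, 9, 10, 14, 16, 18, 19, 20, 25, 28]),
    (64, [0, 1, 4, 9, 16, 17, 25, 33, 36, 41, 49, 57]),
    (41, [0, 1, 2, 4, 5, 8, 9, 10, 16, 18, 20, 21, 23, 25, 31, 32, 33, 36, 37, 39, 40]),
    (23, [0, 1, 2, 3, 4, 6, 8, 9, 12, 13, 16, 18]),
    (37, [0, 1, 3, 4, 7, 9, 10, 11, 12, 16, 21, 25, 26, 27, 28, 30, 33, 34, 36]),
    (17, [0, 1, 2, 4, 8, 9, 13, 15, 16]),
    (63, [0, 1, 4, 7, 9, 16, 18, 22, 25, 28, 36, 37, 43, 46, 49, 58]),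
    (19, [0, 1, 4, 5, 6, 7, 9, 11, 16, 17])]"

text \<open>The conditionals make \<open>code_simp\<close> stop at the first hit; with disjunctions it would
  evaluate every alternative.\<close>

fun occurs :: "int \<Rightarrow> int list \<Rightarrow> bool" where
  "occurs x [] = False"
| "occurs x (y # ys) = (if x = y then True else occurs x ys)"

fun sieved_by :: "(int \<times> int list) list \<Rightarrow> int \<Rightarrow> bool" where
  "sieved_by [] v = False"
| "sieved_by ((q, R) # qs) v = (if occurs (v mod q) R then sieved_by qs v else True)"

lemma square_residues_complete:
  "list_all (\<lambda>(q, R). q > 0 \<and> list_all (\<lambda>i. occurs (i * i mod q) R) [0..q - 1]) square_residues"
  by code_simp

text \<open>A square is congruent to the square of a reduced residue, and those all occur in the
  list; so a value outside the list for one modulus is no square.\<close>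

lemma sieved_by_not_square:
  assumes "sieved_by tab v"
    and "list_all (\<lambda>(q, R). q > 0 \<and> list_all (\<lambda>i. occurs (i * i mod q) R) [0..q - 1]) tab"
  shows "x\<^sup>2 \<noteq> v"
  using assms
proof (induction tab v rule: sieved_by.induct)
  case (2 q R qs v)
  show ?case
  proof (cases "occurs (v mod q) R")
    case False
    have q: "q > 0" "\<forall>i\<in>{0..q-1}. occurs (i * i mod q) R"
      using "2.prems" by (auto simp: list_all_iff)
    have "x mod q \<in> {0..q-1}" using q(1) by simp
    then have "occurs ((x mod q) * (x mod q) mod q) R" using q(2) by blast
    then have "occurs (x\<^sup>2 mod q) R" by (simp add: mod_mult_eq power2_eq_square)
    with False show ?thesis by metis
  qed (use 2 in auto)
qed simp

lemmas sieved_not_square = sieved_by_not_square[OF _ square_residues_complete]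

section \<open>Consecutive squares, and the finite computations for small \<open>k\<close>\<close>

lemma not_square_between:
  fixes x a :: int
  assumes "a \<ge> 0" "a\<^sup>2 < x\<^sup>2" "x\<^sup>2 < (a + 1)\<^sup>2" shows False
proof -
  have "a < \<bar>x\<bar>" by (rule power2_less_imp_less) (use assms in auto)
  moreover have "\<bar>x\<bar> < a + 1" by (rule power2_less_imp_less) (use assms in auto)
  ultimately show False by linarith
qed

text \<open>Here and in the quintic sieves, the ranges end just below the values of \<open>k\<close>
  from which the inequalities used later are proved.\<close>

lemma sieve_cubic:
    "list_all (\<lambda>k. sieved_by square_residues (k ^ 4 - (2 * k - 1) ^ 3)) [2..15]"
    "list_all (\<lambda>k. sieved_by square_residues (k ^ 6 - (2 * k - 1) ^ 3)) [2..6]"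
  by code_simp+

lemma sieve_quintic:
    "list_all (\<lambda>k. sieved_by square_residues (k ^ 8 - (2 * k - 1) ^ 5)) [2..59]"
    "list_all (\<lambda>k. sieved_by square_residues (k ^ 10 - (2 * k - 1) ^ 5)) [2..59]"
    "list_all (\<lambda>k. sieved_by square_residues (k ^ 12 - (2 * k - 1) ^ 5)) [2..15]"
  by code_simp+

lemma sieve_quintic6: "list_all (\<lambda>k. sieved_by square_residues (k ^ 6 - (2 * k - 1) ^ 5)) [2..319]"
  by code_simp

text \<open>For \<open>p \<le> 0\<close> the range of residues is empty and the test vacuous, so a
  successful test returns \<open>p > 0\<close> and not \<open>True\<close>.\<close>

fun rootless_mod :: "int list \<Rightarrow> (int \<Rightarrow> int) \<Rightarrow> bool" where
  "rootless_mod [] f = False"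
| "rootless_mod (p # ps) f = (if list_all (\<lambda>k. f k mod p \<noteq> 0) [0..p - 1] then p > 0 else rootless_mod ps f)"

lemma rootless_modD:
  assumes "rootless_mod ps f" "\<And>p. f (k mod p) mod p = f k mod p"
  shows "f k \<noteq> 0"
  using assms(1)
proof (induction ps)
  case (Cons p ps)
  show ?case
  proof (cases "list_all (\<lambda>k. f k mod p \<noteq> 0) [0..p - 1]")
    case True
    then have "p > 0" using Cons.prems by simp
    then have "f (k mod p) mod p \<noteq> 0" using True by (simp add: list_all_iff)
    then show ?thesis using assms(2)[of p] by auto
  qed (use Cons in auto)
qed simp

text \<open>The polynomial part of the square root of \<open>k ^ 6 - (2 * k - 1) ^ 5\<close> is
  \<open>P = k ^ 3 - 16 * k\<^sup>2 - 88 * k - 1448\<close>; the quadratic is the remainder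
  \<open>P\<^sup>2 - (k ^ 6 - (2 * k - 1) ^ 5)\<close>, so a root \<open>k\<close> means that \<open>P - j\<close> is a square root.
  The list contains, for every \<open>j\<close>, a prime modulo which the cubic has no root.\<close>

lemma sieve_offset:
  "list_all (\<lambda>j. rootless_mod [2, 11, 5, 7, 23, 37, 41, 13] (\<lambda>k.
     2 * j * (k ^ 3 - 16 * k\<^sup>2 - 88 * k - 1448) - j\<^sup>2 - (54040 * k\<^sup>2 + 254858 * k + 2096703))) [1..100]"
  by code_simp

lemma offset_nonzero:
  fixes j k :: int
  assumes "1 \<le> j" "j \<le> 100"
  shows "2 * j * (k ^ 3 - 16 * k\<^sup>2 - 88 * k - 1448) - j\<^sup>2 \<noteq> 54040 * k\<^sup>2 + 254858 * k + 2096703"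
proof -
  let ?G = "\<lambda>k. 2 * j * (k ^ 3 - 16 * k\<^sup>2 - 88 * k - 1448) - j\<^sup>2 - (54040 * k\<^sup>2 + 254858 * k + 2096703)"
  have "j \<in> set [1..100]" using assms by simp
  then have r: "rootless_mod [2, 11, 5, 7, 23, 37, 41, 13] ?G"
    using sieve_offset unfolding list_all_iff by blast
  have "?G (k mod p) mod p = ?G k mod p" for p
    by (intro mod_diff_cong mod_add_cong mod_mult_cong refl) (simp_all add: power_mod)
  from rootless_modD[of _ ?G k, OF r this] show ?thesis by simp
qed

text \<open>The largest square below \<open>(k ^ m)\<^sup>2\<close> is
  \<open>(k ^ m - 1)\<^sup>2\<close>, at distance \<open>2 * k ^ m - 1\<close>.\<close>

lemma even_exponent_bound:
  fixes k x n :: int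
  assumes "x\<^sup>2 + n = k ^ (2 * m)" "n > 0" "k > 1"
  shows "2 * k ^ m \<le> n + 1"
proof (rule ccontr)
  assume *: "\<not> ?thesis"
  have "k ^ m \<ge> 1" using assms(3) by simp
  have "(k ^ m)\<^sup>2 = x\<^sup>2 + n" using assms(1) by (simp flip: power_mult add: mult.commute)
  then have "x\<^sup>2 < (k^m - 1 + 1)\<^sup>2" "(k ^ m - 1)\<^sup>2 < x\<^sup>2"
    using * assms(2) by (simp_all add: power2_diff)
  with not_square_between[of "k^m-1" x] \<open>k ^ m \<ge> 1\<close> show False by simp
qed

lemma sieved_range:
  assumes "list_all (\<lambda>k. sieved_by square_residues (f k)) [a..b]" "a \<le> k" "k \<le> b"
  shows "x\<^sup>2 \<noteq> f k"
proof -
  have "k \<in> set [a..b]" unfolding set_upto using assms(2,3) by simp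
  then have "sieved_by square_residues (f k)" using assms(1) unfolding list_all_iff by blast
  then show ?thesis by (rule sieved_not_square)
qed

lemma less_mult_power_mono:
  fixes k :: int
  assumes "k \<ge> 1" "a * k ^ i > b" "i \<le> m" "a > 0" shows "a * k ^ m > b"
proof -
  have "a * k ^ i \<le> a * k ^ m" using assms by (intro mult_left_mono power_increasing) auto
  then show ?thesis using assms(2) by linarith
qed

text \<open>The gap between squares leaves \<open>m < 4\<close>. For \<open>m \<le> 1\<close> the
  right-hand side is too small; otherwise the polynomial part of the square root traps
  \<open>x\<^sup>2\<close> between consecutive squares for large \<open>k\<close>, and the sieve
  treats the rest.\<close>

lemma cubic_even_exponent:
  fixes k x :: int
  assumes "k > 1" "x\<^sup>2 + (2 * k - 1) ^ 3 = k ^ (2 * m)"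
  shows False
proof -
  have x: "x\<^sup>2 = k ^ (2 * m) - (2 * k - 1) ^ 3" using assms(2) by simp
  \<comment> \<open>Rewritten in a variable bounded below by 0, the polynomial inequalities have
    nonnegative coefficients after cancellation, which simplification can settle. The later shifts
    \<open>s\<close> serve the same purpose.\<close>
  define t where "t = k - 2"
  have k: "k = t + 2" "t \<ge> 0" using assms(1) by (auto simp: t_def)
  have "2 * k ^ m \<le> (2 * k - 1) ^ 3 + 1"
    using assms by (intro even_exponent_bound) auto
  moreover have "2 * k ^ 4 > (2 * k - 1) ^ 3 + 1"
    unfolding k(1) using k(2) by (simp add: algebra_simps power_numeral_reduce add_nonneg_pos add_pos_nonneg)
  ultimately have "m < 4"
    using less_mult_power_mono[of k "(2 * k - 1) ^ 3 + 1" 2 4 m] assms(1) by force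
  then consider "m = 0" | "m = 1" | "m = 2" | "m = 3" by linarith
  then show False
  proof cases
    case 1
    have "(2 * k - 1) ^ 3 > 1" using assms(1) by simp
    then show False using x 1 by (smt (verit) zero_le_power2 mult_0_right power_0)
  next
    case 2
    have "(2 * k - 1) ^ 3 > k\<^sup>2"
      unfolding k(1) using k(2) by (simp add: algebra_simps power_numeral_reduce add_nonneg_pos add_pos_nonneg)
    then show False using x 2 by (smt (verit) zero_le_power2 mult_1_right)
  next
    case 3
    show False
    proof (cases "k \<le> 15")
      case True
      show False using sieved_range[OF sieve_cubic(1) _ True, of x] x 3 assms(1) by simp
    next
      case False
      define s where "s = k - 16"
      have s: "k = s + 16" "s \<ge> 0" using False by (auto simp: s_def)
      \<comment> \<open>The polynomial part of the square root is
        \<open>k\<^sup>2 - 4 * k - 2\<close>, and \<open>x\<^sup>2\<close> lies below its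
        square.\<close>
      show False
      proof (rule not_square_between[of "k\<^sup>2 - 4 * k - 3" x])
        show "0 \<le> k\<^sup>2 - 4 * k - 3"
          unfolding s(1) using s(2) by (simp add: algebra_simps power_numeral_reduce)
        show "(k\<^sup>2 - 4 * k - 3)\<^sup>2 < x\<^sup>2" "x\<^sup>2 < (k\<^sup>2 - 4 * k - 3 + 1)\<^sup>2"
          unfolding x 3 s(1) using s(2) by (simp_all add: algebra_simps power_numeral_reduce add_nonneg_pos add_pos_nonneg)
      qed
    qed
  next
    case 4
    show False
    proof (cases "k \<le> 6")
      case True
      show False using sieved_range[OF sieve_cubic(2) _ True, of x] x 4 assms(1) by simp
    next
      case False
      define s where "s = k - 7"
      have s: "k = s + 7" "s \<ge> 0" using False by (auto simp: s_def)
      \<comment> \<open>The polynomial part is \<open>k ^ 3 - 4\<close>, and this time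
        \<open>x\<^sup>2\<close> lies above its square.\<close>
      show False
      proof (rule not_square_between[of "k ^ 3 - 4" x])
        show "0 \<le> k ^ 3 - 4"
          unfolding s(1) using s(2) by (simp add: algebra_simps power_numeral_reduce)
        show "(k ^ 3 - 4)\<^sup>2 < x\<^sup>2" "x\<^sup>2 < (k ^ 3 - 4 + 1)\<^sup>2"
          unfolding x 4 s(1) using s(2) by (simp_all add: algebra_simps power_numeral_reduce add_nonneg_pos add_pos_nonneg)
      qed
    qed
  qed
qed

text \<open>Trapping \<open>x\<^sup>2\<close> directly below \<open>P\<^sup>2\<close> would need
  \<open>R < 2 * P\<close>, hence \<open>k\<close> beyond 27000. Instead
  \<open>\<bar>x\<bar> = P - j\<close> is allowed for offsets \<open>j\<close> up to 100, and each
  of these is refuted modulo a prime.\<close>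

lemma quintic_sixth_power:
  fixes k x :: int
  assumes "k \<ge> 320"
  shows "x\<^sup>2 \<noteq> k ^ 6 - (2 * k - 1) ^ 5"
proof
  assume x: "x\<^sup>2 = k ^ 6 - (2 * k - 1) ^ 5"
  define P where "P = k ^ 3 - 16 * k\<^sup>2 - 88 * k - 1448"
  define R where "R = 54040 * k\<^sup>2 + 254858 * k + 2096703"
  define s where "s = k - 320"
  have s: "k = s + 320" "s \<ge> 0" using assms by (auto simp: s_def)
  have R: "P\<^sup>2 - \<bar>x\<bar>\<^sup>2 = R" unfolding P_def R_def power2_abs x
    by (simp add: algebra_simps power_numeral_reduce)
  \<comment> \<open>\<open>200 * P - 10000\<close> is \<open>P\<^sup>2 - (P - 100)\<^sup>2\<close>,
    so the second inequality bounds the offset by 100.\<close>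
  have "P > 100" "200 * P - 10000 > R" "R > 0"
    unfolding P_def R_def s(1) using s(2) by (simp_all add: algebra_simps power_numeral_reduce add_nonneg_pos add_pos_nonneg)
  define j where "j = P - \<bar>x\<bar>"
  have j: "2 * j * P - j\<^sup>2 = R" using R unfolding j_def by (simp add: algebra_simps power2_eq_square)
  have "j \<ge> 1"
  proof (rule ccontr)
    assume "\<not> ?thesis"
    then have "P \<le> \<bar>x\<bar>" by (simp add: j_def)
    then have "P\<^sup>2 \<le> \<bar>x\<bar>\<^sup>2" using \<open>P > 100\<close> by (intro power_mono) auto
    then show False using R \<open>R > 0\<close> by simp
  qed
  moreover have "j \<le> 100"
  proof (rule ccontr)
    assume "\<not> ?thesis"
    then have "\<bar>x\<bar> \<le> P - 100" by (simp add: j_def)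
    then have "\<bar>x\<bar>\<^sup>2 \<le> (P - 100)\<^sup>2" by (intro power_mono) auto
    then show False using R \<open>200 * P - 10000 > R\<close> by (simp add: power2_eq_square algebra_simps)
  qed
  ultimately show False using offset_nonzero[of j k] j by (simp add: P_def R_def)
qed

text \<open>As in the cubic case, now with \<open>m < 7\<close>. The polynomial parts are
  \<open>k ^ 4 - 16 * k + 40\<close>, approached from below, for \<open>m = 4\<close> and
  \<open>k ^ 5 - 16\<close>, approached from above, for \<open>m = 5\<close>; \<open>m = 3\<close>
  needs the offset argument, and for \<open>m = 6\<close> the gap bound already suffices once
  \<open>k \<ge> 16\<close>.\<close>

lemma quintic_even_exponent:
  fixes k x :: int
  assumes "k > 1" "x\<^sup>2 + (2 * k - 1) ^ 5 = k ^ (2 * m)"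
  shows False
proof -
  have x: "x\<^sup>2 = k ^ (2 * m) - (2 * k - 1) ^ 5" using assms(2) by simp
  define t where "t = k - 2"
  have k: "k = t + 2" "t \<ge> 0" using assms(1) by (auto simp: t_def)
  have bound: "2 * k ^ m \<le> (2 * k - 1) ^ 5 + 1"
    using assms by (intro even_exponent_bound) auto
  moreover have "2 * k ^ 7 > (2 * k - 1) ^ 5 + 1"
    unfolding k(1) using k(2) by (simp add: algebra_simps power_numeral_reduce add_nonneg_pos add_pos_nonneg)
  ultimately have "m < 7"
    using less_mult_power_mono[of k "(2 * k - 1) ^ 5 + 1" 2 7 m] assms(1) by force
  then consider "m \<le> 2" | "m = 3" | "m = 4" | "m = 5" | "m = 6" by linarith
  then show False
  proof cases
    case 1
    have "k ^ (2 * m) \<le> k ^ 4" using assms(1) 1 by (intro power_increasing) auto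
    moreover have "(2 * k - 1) ^ 5 > k ^ 4"
      unfolding k(1) using k(2) by (simp add: algebra_simps power_numeral_reduce add_nonneg_pos add_pos_nonneg)
    ultimately show False using x by (smt (verit) zero_le_power2)
  next
    case 2
    show False
    proof (cases "k \<le> 319")
      case True
      show False using sieved_range[OF sieve_quintic6 _ True, of x] x 2 assms(1) by simp
    qed (use quintic_sixth_power[of k x] x 2 in auto)
  next
    case 3
    show False
    proof (cases "k \<le> 59")
      case True
      show False using sieved_range[OF sieve_quintic(1) _ True, of x] x 3 assms(1) by simp
    next
      case False
      define s where "s = k - 60"
      have s: "k = s + 60" "s \<ge> 0" using False by (auto simp: s_def)
      show False
      proof (rule not_square_between[of "k ^ 4 - 16 * k + 39" x])
        show "0 \<le> k ^ 4 - 16 * k + 39"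
          unfolding s(1) using s(2) by (simp add: algebra_simps power_numeral_reduce)
        show "(k ^ 4 - 16 * k + 39)\<^sup>2 < x\<^sup>2" "x\<^sup>2 < (k ^ 4 - 16 * k + 39 + 1)\<^sup>2"
          unfolding x 3 s(1) using s(2) by (simp_all add: algebra_simps power_numeral_reduce add_nonneg_pos add_pos_nonneg)
      qed
    qed
  next
    case 4
    show False
    proof (cases "k \<le> 59")
      case True
      show False using sieved_range[OF sieve_quintic(2) _ True, of x] x 4 assms(1) by simp
    next
      case False
      define s where "s = k - 60"
      have s: "k = s + 60" "s \<ge> 0" using False by (auto simp: s_def)
      show False
      proof (rule not_square_between[of "k ^ 5 - 16" x])
        show "0 \<le> k ^ 5 - 16"
          unfolding s(1) using s(2) by (simp add: algebra_simps power_numeral_reduce)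
        show "(k ^ 5 - 16)\<^sup>2 < x\<^sup>2" "x\<^sup>2 < (k ^ 5 - 16 + 1)\<^sup>2"
          unfolding x 4 s(1) using s(2) by (simp_all add: algebra_simps power_numeral_reduce add_nonneg_pos add_pos_nonneg)
      qed
    qed
  next
    case 5
    show False
    proof (cases "k \<le> 15")
      case True
      show False using sieved_range[OF sieve_quintic(3) _ True, of x] x 5 assms(1) by simp
    next
      case False
      define s where "s = k - 16"
      have s: "k = s + 16" "s \<ge> 0" using False by (auto simp: s_def)
      have "2 * k ^ 6 > (2 * k - 1) ^ 5 + 1"
        unfolding s(1) using s(2) by (simp add: algebra_simps power_numeral_reduce add_nonneg_pos add_pos_nonneg)
      then show False using bound 5 by simp
    qed
  qed
qed

section \<open>Proper equivalence of forms\<close>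

definition represents_via :: "bqf \<Rightarrow> bqf \<Rightarrow> int \<Rightarrow> int \<Rightarrow> int \<Rightarrow> int \<Rightarrow> bool" where
  "represents_via f g p q r s \<longleftrightarrow> p * s - q * r = 1 \<and>
     (\<forall>X Y. bqf_eval g X Y = bqf_eval f (p * X + q * Y) (r * X + s * Y))"

lemma bqf_equiv_iff:
  "(f, g) \<in> bqf_equiv D \<longleftrightarrow> f \<in> primitive_forms D \<and> g \<in> primitive_forms D \<and> (\<exists>p q r s. represents_via f g p q r s)"
  by (auto simp: bqf_equiv_def represents_via_def)

text \<open>A binary quadratic form is determined by its values at (1, 0), (0, 1) and (1,
  1).\<close>

lemma represents_via_iff:
  "represents_via (a, b, c) (a', b', c') p q r s \<longleftrightarrow> p * s - q * r = 1 \<and>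
     a' = a * p^2 + b * p * r + c * r^2 \<and>
     b' = 2 * a * p * q + b * (p * s + q * r) + 2 * c * r * s \<and>
     c' = a * q^2 + b * q * s + c * s^2" (is "?L \<longleftrightarrow> ?R")
proof
  assume L: ?L
  then have e: "\<And>X Y. bqf_eval (a', b', c') X Y = bqf_eval (a, b, c) (p * X + q * Y) (r * X + s * Y)"
    by (simp add: represents_via_def)
  have 1: "a' = a * p^2 + b * p * r + c * r^2" using e[of 1 0] by simp
  have 2: "c' = a * q^2 + b * q * s + c * s^2" using e[of 0 1] by simp
  have "a' + b' + c' = a * (p + q)^2 + b * (p + q) * (r + s) + c * (r + s)^2" using e[of 1 1] by simp
  then have "b' = 2 * a * p * q + b * (p * s + q * r) + 2 * c * r * s"
    unfolding 1 2 by (simp add: algebra_simps power2_eq_square)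
  with 1 2 L show ?R by (simp add: represents_via_def)
next
  assume ?R then show ?L
    unfolding represents_via_def by (simp add: algebra_simps power2_eq_square)
qed

lemma bqf_primitive_iff:
  "bqf_primitive (a, b, c) \<longleftrightarrow> (\<forall>d. d dvd a \<and> d dvd b \<and> d dvd c \<longrightarrow> d dvd 1)"
proof -
  have "bqf_primitive (a, b, c) \<longleftrightarrow> is_unit (gcd a (gcd b c))"
    unfolding bqf_primitive.simps by (rule is_unit_gcd_iff[symmetric])
  also have "\<dots> \<longleftrightarrow> (\<forall>d. d dvd gcd a (gcd b c) \<longrightarrow> is_unit d)"
    by (meson dvd_refl dvd_trans)
  finally show ?thesis by simp
qed

lemma represents_via_refl: "represents_via f f 1 0 0 1"
  by (simp add: represents_via_def)

lemma represents_via_inverse: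
  assumes "represents_via f g p q r s"
  shows "represents_via g f s (- q) (- r) p"
proof -
  have d: "p * s - q * r = 1" and e: "\<And>X Y. bqf_eval g X Y = bqf_eval f (p * X + q * Y) (r * X + s * Y)"
    using assms by (auto simp: represents_via_def)
  have "bqf_eval f X Y = bqf_eval g (s * X + (- q) * Y) ((- r) * X + p * Y)" for X Y
  proof -
    have "p * (s * X + (- q) * Y) + q * ((- r) * X + p * Y) = (p * s - q * r) * X"
      "r * (s * X + (- q) * Y) + s * ((- r) * X + p * Y) = (p * s - q * r) * Y"
      by (simp_all add: algebra_simps)
    then show ?thesis unfolding e d by simp
  qed
  with d show ?thesis unfolding represents_via_def by (auto simp: mult.commute)
qed

lemma represents_via_comp:
  assumes "represents_via f g p q r s" "represents_via g h p' q' r' s'"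
  shows "represents_via f h (p * p' + q * r') (p * q' + q * s') (r * p' + s * r') (r * q' + s * s')"
proof -
  have "(p * p' + q * r') * (r * q' + s * s') - (p * q' + q * s') * (r * p' + s * r')
     = (p * s - q * r) * (p' * s' - q' * r')" by (simp add: algebra_simps)
  moreover have "bqf_eval h X Y = bqf_eval f ((p * p' + q * r') * X + (p * q' + q * s') * Y)
     ((r * p' + s * r') * X + (r * q' + s * s') * Y)" for X Y
  proof -
    have "bqf_eval h X Y = bqf_eval f (p * (p' * X + q' * Y) + q * (r' * X + s' * Y))
        (r * (p' * X + q' * Y) + s * (r' * X + s' * Y))"
      using assms by (simp add: represents_via_def)
    also have "p * (p' * X + q' * Y) + q * (r' * X + s' * Y) = (p * p' + q * r') * X + (p * q' + q * s') * Y"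
      by (simp add: algebra_simps)
    also have "r * (p' * X + q' * Y) + s * (r' * X + s' * Y) = (r * p' + s * r') * X + (r * q' + s * s') * Y"
      by (simp add: algebra_simps)
    finally show ?thesis .
  qed
  ultimately show ?thesis using assms unfolding represents_via_def by simp
qed

lemma equiv_bqf_equiv: "equiv (primitive_forms D) (bqf_equiv D)"
proof (rule equivI)
  show "bqf_equiv D \<subseteq> primitive_forms D \<times> primitive_forms D"
    by (auto simp: bqf_equiv_def)
  show "refl_on (primitive_forms D) (bqf_equiv D)"
    by (rule refl_onI) (use represents_via_refl in \<open>blast intro: bqf_equiv_iff[THEN iffD2]\<close>)
  show "sym (bqf_equiv D)"
    by (rule symI) (use represents_via_inverse in \<open>unfold bqf_equiv_iff, blast\<close>)
  show "trans (bqf_equiv D)"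
    by (rule transI) (use represents_via_comp in \<open>unfold bqf_equiv_iff, blast\<close>)
qed

text \<open>The discriminant is multiplied by the square of the determinant, and the inverse
  substitution carries a common divisor of the new coefficients back to the old ones.\<close>

lemma represents_via_primitive_forms:
  assumes "represents_via f g p q r s" "f \<in> primitive_forms D"
  shows "g \<in> primitive_forms D"
proof -
  obtain a b c where f: "f = (a, b, c)" by (cases f) auto
  obtain a' b' c' where g: "g = (a', b', c')" by (cases g) auto
  have F: "p * s - q * r = 1" "a' = a * p^2 + b * p * r + c * r^2"
     "b' = 2 * a * p * q + b * (p * s + q * r) + 2 * c * r * s"
     "c' = a * q^2 + b * q * s + c * s^2"
    using assms(1) unfolding f g represents_via_iff by auto
  have G: "a = a' * s^2 + b' * s * (-r) + c' * (-r)^2"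
     "b = 2 * a' * s * (-q) + b' * (s * p + (-q) * (-r)) + 2 * c' * (-r) * p"
     "c = a' * (-q)^2 + b' * (-q) * p + c' * p^2"
    using represents_via_inverse[OF assms(1)] unfolding f g represents_via_iff by auto
  have "b'^2 - 4 * a' * c' = (p * s - q * r)^2 * (b^2 - 4 * a * c)"
    unfolding F(2-4) by (simp add: algebra_simps power2_eq_square)
  moreover have "bqf_primitive g"
    unfolding g bqf_primitive_iff
  proof (intro allI impI)
    fix d assume d: "d dvd a' \<and> d dvd b' \<and> d dvd c'"
    then have "d dvd a" "d dvd b" "d dvd c"
      unfolding G by (intro dvd_add; simp)+
    then show "d dvd 1" using assms(2) unfolding primitive_forms_def f using bqf_primitive_iff by blast
  qed
  ultimately show ?thesis using assms(2) F(1) by (simp add: primitive_forms_def f g)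
qed

section \<open>Values of a primitive form coprime to a given integer\<close>

lemma primitive_represents_coprime:
  fixes a b c n :: int
  assumes "n \<noteq> 0" and prim: "\<And>p. prime p \<Longrightarrow> p dvd a \<Longrightarrow> p dvd b \<Longrightarrow> p dvd c \<Longrightarrow> False"
  obtains x y where "coprime x y" "coprime (a * x^2 + b * x * y + c * y^2) n"
proof -
  \<comment> \<open>Each prime dividing \<open>n\<close> divides all but one of the three terms at \<open>(x, y)\<close>.\<close>
  define x where "x = \<Prod>{p \<in> prime_factors n. p dvd a \<and> \<not> p dvd c}"
  define y where "y = \<Prod>{p \<in> prime_factors n. \<not> p dvd a}"
  have X: "p dvd x \<longleftrightarrow> p dvd n \<and> p dvd a \<and> \<not> p dvd c" if p: "prime p" for p
  proof -
    have "p dvd x \<longleftrightarrow> (\<exists>q\<in>{p \<in> prime_factors n. p dvd a \<and> \<not> p dvd c}. p dvd q)"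
      unfolding x_def using p by (simp add: prime_dvd_prod_iff)
    also have "\<dots> \<longleftrightarrow> p dvd n \<and> p dvd a \<and> \<not> p dvd c"
      using p assms(1) by (auto simp: in_prime_factors_iff dest: primes_dvd_imp_eq)
    finally show ?thesis .
  qed
  have Y: "p dvd y \<longleftrightarrow> p dvd n \<and> \<not> p dvd a" if p: "prime p" for p
  proof -
    have "p dvd y \<longleftrightarrow> (\<exists>q\<in>{p \<in> prime_factors n. \<not> p dvd a}. p dvd q)"
      unfolding y_def using p by (simp add: prime_dvd_prod_iff)
    also have "\<dots> \<longleftrightarrow> p dvd n \<and> \<not> p dvd a"
      using p assms(1) by (auto simp: in_prime_factors_iff dest: primes_dvd_imp_eq)
    finally show ?thesis .
  qed
  have cop: "coprime u v" if "u \<noteq> 0 \<or> v \<noteq> 0" "\<And>p. prime p \<Longrightarrow> p dvd u \<Longrightarrow> p dvd v \<Longrightarrow> False" for u v :: int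
  proof (rule ccontr)
    assume "\<not> coprime u v"
    then have "gcd u v \<noteq> 0" "\<not> is_unit (gcd u v)" using that(1) by (auto simp: is_unit_gcd)
    then obtain p where "p dvd gcd u v" "prime p" using prime_divisor_exists by blast
    then show False using that(2)[of p] by simp
  qed
  have "x \<noteq> 0" unfolding x_def by (auto simp: prod_zero_iff in_prime_factors_iff)
  show ?thesis
  proof (rule that)
    show "coprime x y" using \<open>x \<noteq> 0\<close> X Y by (intro cop) auto
    show "coprime (a * x^2 + b * x * y + c * y^2) n"
    proof (rule cop)
      fix p :: int assume p: "prime p" "p dvd a * x^2 + b * x * y + c * y^2" "p dvd n"
      note pm = prime_dvd_mult_iff[OF p(1)] prime_dvd_power_iff[OF p(1)]
      show False
      proof (cases "p dvd a")
        case True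
        then have ny: "\<not> p dvd y" using Y p by auto
        show False
        proof (cases "p dvd c")
          case True
          have "p dvd (a * x^2 + b * x * y + c * y^2) - a * x^2 - c * y^2"
            using \<open>p dvd a\<close> True p by (intro dvd_diff) auto
          then have "p dvd b * x * y" by simp
          then show False using ny True X[OF p(1)] prim[OF p(1) \<open>p dvd a\<close>] pm by auto
        next
          case False
          then have "p dvd x" using X p True by auto
          have "p dvd (a * x^2 + b * x * y + c * y^2) - x * (a * x + b * y)"
            using \<open>p dvd x\<close> p by (intro dvd_diff) auto
          then have "p dvd c * y^2" by (simp add: algebra_simps power2_eq_square)
          then show False using False ny pm by auto
        qed
      next
        case False
        then have y: "p dvd y" and nx: "\<not> p dvd x" using X Y p by auto
        have "p dvd (a * x^2 + b * x * y + c * y^2) - y * (b * x + c * y)"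
            using y p by (intro dvd_diff) auto
        then have "p dvd a * x^2" by (simp add: algebra_simps power2_eq_square)
        then show False using False nx pm by auto
      qed
    qed (use assms in simp)
  qed
qed

section \<open>Composition with a fixed class\<close>

text \<open>Every orbit has exactly \<open>n\<close> elements: a return after \<open>d < n\<close>
  steps has \<open>d\<close> coprime to \<open>n\<close>, and a Bezout relation between the periods
  \<open>d\<close> and \<open>n\<close> would produce a fixed point. The orbits partition
  \<open>S\<close>.\<close>

lemma prime_period_dvd_card:
  fixes T :: "'a \<Rightarrow> 'a"
  assumes "finite S" "prime n" and closed: "\<And>a. a \<in> S \<Longrightarrow> T a \<in> S"
    and period: "\<And>a. a \<in> S \<Longrightarrow> (T ^^ n) a = a" and free: "\<And>a. a \<in> S \<Longrightarrow> T a \<noteq> a"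
  shows "n dvd card S"
proof -
  have S: "(T ^^ i) a \<in> S" if "a \<in> S" for i a
    using that closed by (induction i) auto
  have add: "(T ^^ (i + j)) a = (T ^^ i) ((T ^^ j) a)" for i j a
    by (simp add: funpow_add)
  have per: "(T ^^ (m * i)) a = a" if "a \<in> S" "(T ^^ m) a = a" for m i a
    using that by (induction i) (simp_all add: add)
  have inj: "inj_on (\<lambda>i. (T ^^ i) a) {..<n}" if a: "a \<in> S" for a
  proof (rule linorder_inj_onI')
    fix i j assume ij: "i \<in> {..<n}" "j \<in> {..<n}" "i < j"
    show "(T ^^ i) a \<noteq> (T ^^ j) a"
    proof
      assume eq: "(T ^^ i) a = (T ^^ j) a"
      have "a = (T ^^ (n - i)) ((T ^^ i) a)" using period[OF a] ij by (simp flip: add)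
      also have "\<dots> = (T ^^ (n - i + j)) a" unfolding eq add ..
      also have "n - i + j = (j - i) + n" using ij by simp
      also have "(T ^^ ((j - i) + n)) a = (T ^^ (j - i)) a" using period[OF a] by (simp add: add)
      finally have d: "(T ^^ (j - i)) a = a" by simp
      have "coprime n (j - i)"
        using ij by (intro prime_imp_coprime[OF assms(2)]) (auto dest: dvd_imp_le)
      then have "coprime (j - i) n" by (simp add: coprime_commute)
      moreover have "j - i \<noteq> 0" using ij by simp
      ultimately obtain x w where xw: "(j - i) * x = n * w + 1" using bezout_nat[of "j - i" n] by auto
      have "a = (T ^^ ((j - i) * x)) a" using per[OF a d] by simp
      also have "\<dots> = T ((T ^^ (n * w)) a)" unfolding xw by simp
      also have "\<dots> = T a" using per[OF a period[OF a]] by simp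
      finally show False using free[OF a] by simp
    qed
  qed
  define r where "r = {(a, b). a \<in> S \<and> (\<exists>i. b = (T ^^ i) a)}"
  have "equiv S r"
  proof (rule equivI)
    show "r \<subseteq> S \<times> S" using S by (auto simp: r_def)
    show "refl_on S r" by (rule refl_onI) (auto simp: r_def intro: exI[of _ 0])
    show "sym r"
    proof (rule symI)
      fix a b assume "(a, b) \<in> r"
      then obtain i where i: "a \<in> S" "b = (T ^^ i) a" by (auto simp: r_def)
      \<comment> \<open>\<open>n * i - i\<close> further steps undo \<open>i\<close> steps, since
        together they make \<open>i\<close> full periods; \<open>n \<ge> 1\<close> makes the
        subtraction of naturals exact.\<close>
      have "n \<ge> 1" using assms(2) prime_ge_1_nat by blast
      then have e: "(n * i - i) + i = n * i" by simp
      have "(T ^^ (n * i - i)) b = (T ^^ ((n * i - i) + i)) a" unfolding i(2) add ..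
      then have "a = (T ^^ (n * i - i)) b" unfolding e using per[OF i(1) period[OF i(1)], of i] by simp
      then have "\<exists>j. a = (T ^^ j) b" by (rule exI)
      moreover have "b \<in> S" unfolding i(2) by (rule S[OF i(1)])
      ultimately show "(b, a) \<in> r" by (simp add: r_def)
    qed
    show "trans r"
    proof (rule transI)
      fix a b c assume "(a, b) \<in> r" "(b, c) \<in> r"
      then obtain i j where "a \<in> S" "b = (T ^^ i) a" "c = (T ^^ j) b" by (auto simp: r_def)
      then have "a \<in> S \<and> c = (T ^^ (j + i)) a" by (simp add: add)
      then show "(a, c) \<in> r" unfolding r_def by blast
    qed
  qed
  then show ?thesis
  proof (rule equiv_imp_dvd_card[OF assms(1)])
    fix X assume "X \<in> S // r"
    then obtain a where a: "a \<in> S" "X = r `` {a}" by (auto elim: quotientE)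
    have "X = (\<lambda>i. (T ^^ i) a) ` {..<n}"
    proof
      show "X \<subseteq> (\<lambda>i. (T ^^ i) a) ` {..<n}"
      proof
        fix b assume "b \<in> X"
        then obtain i where i: "b = (T ^^ i) a" using a by (auto simp: r_def)
        have "(T ^^ (i mod n + n * (i div n))) a = (T ^^ (i mod n)) a"
          unfolding add using per[OF a(1) period[OF a(1)]] by simp
        then have "b = (T ^^ (i mod n)) a" using i by simp
        moreover have "i mod n < n" using assms(2) prime_gt_0_nat by simp
        ultimately show "b \<in> (\<lambda>i. (T ^^ i) a) ` {..<n}" by blast
      qed
      show "(\<lambda>i. (T ^^ i) a) ` {..<n} \<subseteq> X" using a by (auto simp: r_def)
    qed
    then show "n dvd card X" using inj[OF a(1)] by (simp add: card_image)
  qed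
qed

lemma primitive_forms_even_iff:
  "(a, 2 * b, c) \<in> primitive_forms (4 * k) \<longleftrightarrow> bqf_primitive (a, 2 * b, c) \<and> b\<^sup>2 - a * c = k"
proof -
  have "(2 * b)\<^sup>2 - 4 * a * c = 4 * (b\<^sup>2 - a * c)" by (simp add: algebra_simps power2_eq_square)
  then have "(2 * b)\<^sup>2 - 4 * a * c = 4 * k \<longleftrightarrow> b\<^sup>2 - a * c = k" by presburger
  then show ?thesis unfolding primitive_forms_def mem_Collect_eq bqf_disc.simps by simp
qed

text \<open>The equations say that all minors of the two triples vanish. If
  \<open>w * A + m * B + n * C = 1\<close>, the factor must be
  \<open>w * S + m * R + n * Q\<close>.\<close>

lemma primitive_proportional:
  fixes A B C S R Q :: int
  assumes "\<And>d. d dvd A \<Longrightarrow> d dvd B \<Longrightarrow> d dvd C \<Longrightarrow> d dvd 1"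
    and e: "S * B = R * A" "S * C = Q * A" "R * C = Q * B"
  obtains v where "S = v * A" "R = v * B" "Q = v * C"
proof -
  have "is_unit (gcd A (gcd B C))" using assms(1) by (meson dvd_trans gcd_dvd1 gcd_dvd2)
  then have g: "gcd A (gcd B C) = 1" by simp
  obtain w z where 1: "w * A + z * gcd B C = 1" using bezout_int[of A "gcd B C"] g by metis
  obtain z1 z2 where 2: "z1 * B + z2 * C = gcd B C" using bezout_int by blast
  define m n where "m = z * z1" and "n = z * z2"
  have b: "w * A + m * B + n * C = 1" using 1 unfolding 2[symmetric] m_def n_def by (simp add: algebra_simps)
  define v where "v = w * S + m * R + n * Q"
  have "v * A = w * (S * A) + m * (R * A) + n * (Q * A)" unfolding v_def by (simp add: algebra_simps)
  also have "\<dots> = S * (w * A + m * B + n * C)" unfolding e[symmetric] by (simp add: algebra_simps)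
  finally have A: "S = v * A" unfolding b by simp
  have "v * B = w * (S * B) + m * (R * B) + n * (Q * B)" unfolding v_def by (simp add: algebra_simps)
  also have "\<dots> = R * (w * A + m * B + n * C)" unfolding e(1) e(3)[symmetric] by (simp add: algebra_simps)
  finally have B: "R = v * B" unfolding b by simp
  have "v * C = w * (S * C) + m * (R * C) + n * (Q * C)" unfolding v_def by (simp add: algebra_simps)
  also have "\<dots> = Q * (w * A + m * B + n * C)" unfolding e(2,3) by (simp add: algebra_simps)
  finally have "Q = v * C" unfolding b by simp
  with A B show thesis by (rule that)
qed

text \<open>With a leading coefficient \<open>a\<close> coprime to \<open>M\<close>, the translation
  by \<open>t\<close> can bring \<open>b\<close> to \<open>\<beta>\<close> modulo \<open>M\<close>.
  Then \<open>M\<close> divides \<open>b\<^sup>2 - k\<close>, which is \<open>a\<close> times the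
  last coefficient, and hence divides the last coefficient.\<close>

lemma divisible_representative:
  fixes k M \<beta> :: int
  assumes "M \<noteq> 0" "M dvd \<beta>\<^sup>2 - k" and f: "f \<in> primitive_forms (4 * k)"
  obtains a b c where "(f, (a, 2 * b, M * c)) \<in> bqf_equiv (4 * k)" "M dvd b - \<beta>"
proof -
  obtain a0 b0 c0 where f0: "f = (a0, b0, c0)" by (cases f) auto
  have "bqf_primitive (a0, b0, c0)" using f by (simp add: f0 primitive_forms_def)
  then have "\<And>p. prime p \<Longrightarrow> p dvd a0 \<Longrightarrow> p dvd b0 \<Longrightarrow> p dvd c0 \<Longrightarrow> False"
    using not_prime_unit unfolding bqf_primitive_iff by blast
  then obtain x y where xy: "coprime x y" "coprime (a0 * x\<^sup>2 + b0 * x * y + c0 * y\<^sup>2) M"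
    using primitive_represents_coprime[OF assms(1), of a0 b0 c0] by metis
  define a where "a = a0 * x\<^sup>2 + b0 * x * y + c0 * y\<^sup>2"
  obtain s q' where "s * x + q' * y = 1" using bezout_int[of x y] xy(1) by auto
  then have det: "x * s - (- q') * y = 1" by (simp add: algebra_simps)
  obtain b1 c1 where g: "represents_via f (a, b1, c1) x (- q') y s"
    using det unfolding f0 represents_via_iff a_def by (metis (no_types))
  then have gp: "(a, b1, c1) \<in> primitive_forms (4 * k)" using represents_via_primitive_forms f by blast
  then have d1: "b1\<^sup>2 - 4 * a * c1 = 4 * k" by (simp add: primitive_forms_def)
  then have "b1\<^sup>2 = 2 * (2 * k + 2 * a * c1)" by simp
  then have "even (b1\<^sup>2)" by (metis dvd_triv_left)
  then obtain b2 where b2: "b1 = 2 * b2" by auto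
  obtain i j where ij: "i * a + j * M = 1" using bezout_int[of a M] xy(2) by (auto simp: a_def)
  define t where "t = i * (\<beta> - b2)"
  define b where "b = b2 + a * t"
  define c2 where "c2 = a * t\<^sup>2 + b1 * t + c1"
  have "represents_via (a, b1, c1) (a, 2 * b, c2) 1 t 0 1"
    unfolding represents_via_iff b_def c2_def b2 by (simp add: algebra_simps power2_eq_square)
  then have h: "represents_via f (a, 2 * b, c2) (x * 1 + - q' * 0) (x * t + - q' * 1) (y * 1 + s * 0) (y * t + s * 1)"
    using represents_via_comp[OF g] by blast
  then have hp: "(a, 2 * b, c2) \<in> primitive_forms (4 * k)" using represents_via_primitive_forms f by blast
  have "b - \<beta> = (i * a - 1) * (\<beta> - b2)" unfolding b_def t_def by (simp add: algebra_simps)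
  also have "i * a - 1 = - j * M" using ij by simp
  finally have bb: "M dvd b - \<beta>" by simp
  have "a * c2 = (b - \<beta>) * (b + \<beta>) + (\<beta>\<^sup>2 - k)"
    using hp unfolding primitive_forms_even_iff by (simp add: algebra_simps power2_eq_square)
  then have "M dvd a * c2" using bb assms(2) by (metis dvd_add dvd_mult2)
  then have "M dvd c2" using xy(2) by (simp add: a_def coprime_commute coprime_dvd_mult_right_iff)
  then obtain c where "c2 = M * c" by blast
  with h hp f bb that show thesis unfolding bqf_equiv_iff by blast
qed

text \<open>Composition with the class of the form \<open>(N, 2 * \<beta>, (\<beta>\<^sup>2 - k) div N)\<close>: only
  representatives \<open>(a, 2 * b, N * c)\<close> with \<open>b\<close> congruent to \<open>\<beta>\<close> are used.\<close>

definition compose_step :: "int \<Rightarrow> int \<Rightarrow> int \<Rightarrow> bqf set \<Rightarrow> bqf set" where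
  "compose_step k N \<beta> C = bqf_equiv (4 * k) ``
     {(a * N, 2 * b, c) | a b c. (a, 2 * b, N * c) \<in> C \<and> N dvd b - \<beta>}"

text \<open>Modulo \<open>N\<close>, \<open>b\<^sup>2\<close> is congruent to the unit
  \<open>k\<close>, and 2 is a unit as \<open>N\<close> is odd.\<close>

lemma coprime_congruent_root:
  fixes N k b \<beta> :: int
  assumes "odd N" "coprime N k" "N dvd \<beta>\<^sup>2 - k" "N dvd b - \<beta>"
  shows "coprime N (2 * b)"
proof -
  have "b\<^sup>2 - k = (b - \<beta>) * (b + \<beta>) + (\<beta>\<^sup>2 - k)" by (simp add: algebra_simps power2_eq_square)
  then have "N dvd b\<^sup>2 - k" using assms by (metis dvd_add dvd_mult2)
  then obtain m where "b\<^sup>2 - k = N * m" by blast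
  then have m: "k = b\<^sup>2 + N * (- m)" by simp
  have "coprime N b"
  proof (rule coprimeI)
    fix d assume d: "d dvd N" "d dvd b"
    then have "d dvd k" unfolding m by (simp add: power2_eq_square)
    then show "is_unit d" using d assms(2) coprime_common_divisor by blast
  qed
  moreover have "coprime N 2" using assms(1) by simp
  ultimately show ?thesis by simp
qed

lemma compose_step_primitive:
  assumes "odd N" "coprime N k" "N dvd \<beta>\<^sup>2 - k" "N dvd b - \<beta>"
    and f: "(a, 2 * b, N * c) \<in> primitive_forms (4 * k)"
  shows "(a * N, 2 * b, c) \<in> primitive_forms (4 * k)"
proof -
  have "bqf_primitive (a * N, 2 * b, c)"
    unfolding bqf_primitive_iff
  proof (intro allI impI)
    fix d assume d: "d dvd a * N \<and> d dvd 2 * b \<and> d dvd c"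
    then have "coprime d N"
      using coprime_congruent_root[OF assms(1-4)] coprime_divisors[of d "2 * b" N N]
      by (simp add: coprime_commute)
    then have "d dvd a" using d by (simp add: coprime_dvd_mult_left_iff)
    then show "is_unit d" using f d unfolding primitive_forms_even_iff bqf_primitive_iff by auto
  qed
  then show ?thesis using f unfolding primitive_forms_even_iff by (simp add: mult.assoc)
qed

text \<open>Makes composition well defined on classes. The matrix between the two representatives
  has \<open>q\<close> divisible by \<open>N\<close>, so conjugating it by the diagonal matrix with
  entries \<open>N\<close> and 1 keeps it integral.\<close>

lemma compose_step_respects:
  assumes N: "N \<noteq> 0" "odd N" "coprime N k" "N dvd \<beta>\<^sup>2 - k"
    and b: "N dvd b - \<beta>" "N dvd b' - \<beta>"
    and eq: "((a, 2 * b, N * c), (a', 2 * b', N * c')) \<in> bqf_equiv (4 * k)"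
  shows "((a * N, 2 * b, c), (a' * N, 2 * b', c')) \<in> bqf_equiv (4 * k)"
proof -
  obtain p q r s where *: "represents_via (a, 2 * b, N * c) (a', 2 * b', N * c') p q r s"
    and pf: "(a, 2 * b, N * c) \<in> primitive_forms (4 * k)" "(a', 2 * b', N * c') \<in> primitive_forms (4 * k)"
    using eq unfolding bqf_equiv_iff by blast
  have det: "p * s - q * r = 1" and e1: "a' = a * p\<^sup>2 + 2 * b * p * r + N * c * r\<^sup>2"
    and e2: "b' = a * p * q + b * (p * s + q * r) + N * c * r * s"
    and e3: "N * c' = a * q\<^sup>2 + 2 * b * q * s + N * c * s\<^sup>2"
    using * unfolding represents_via_iff by auto
  have "q * (a * q + 2 * b * s) = N * (c' - c * s\<^sup>2)"
    using e3 by (simp add: algebra_simps power2_eq_square)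
  then have 1: "N dvd q * (a * q + 2 * b * s)" by simp
  have ps: "p * s = 1 + q * r" using det by simp
  have "q * (a * p + 2 * b * r) = (b' - \<beta>) - (b - \<beta>) - N * (c * r * s)"
    unfolding e2 ps by (simp add: algebra_simps)
  then have 2: "N dvd q * (a * p + 2 * b * r)" using b by (metis dvd_diff dvd_triv_left)
  \<comment> \<open>Eliminating \<open>a\<close> from the two divisibilities leaves
    \<open>2 * b * q\<close>, and \<open>2 * b\<close> is a unit modulo \<open>N\<close>.\<close>
  have "(2 * b) * q = (p * s - q * r) * (2 * b * q)" unfolding det by simp
  also have "\<dots> = p * (q * (a * q + 2 * b * s)) - q * (q * (a * p + 2 * b * r))"
    by (simp add: algebra_simps)
  finally have "N dvd (2 * b) * q" using 1 2 by simp
  then have "N dvd q"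
    using coprime_congruent_root[OF N(2-4) b(1)] by (simp only: coprime_dvd_mult_right_iff)
  then obtain q' where q': "q = N * q'" by blast
  have "N * c' = N * (a * N * q'\<^sup>2 + 2 * b * q' * s + c * s\<^sup>2)"
    unfolding e3 q' by (simp add: algebra_simps power2_eq_square)
  then have "c' = a * N * q'\<^sup>2 + 2 * b * q' * s + c * s\<^sup>2" using N(1) by simp
  then have "represents_via (a * N, 2 * b, c) (a' * N, 2 * b', c') p q' (N * r) s"
    using det unfolding represents_via_iff e1 e2 q' by (simp add: algebra_simps power2_eq_square)
  then show ?thesis
    using compose_step_primitive[OF N(2-4)] b pf unfolding bqf_equiv_iff by blast
qed

lemma compose_step_class:
  assumes N: "N \<noteq> 0" "odd N" "coprime N k" "N dvd \<beta>\<^sup>2 - k" and b: "N dvd b - \<beta>"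
    and f: "(a, 2 * b, N * c) \<in> primitive_forms (4 * k)"
  shows "compose_step k N \<beta> (bqf_equiv (4 * k) `` {(a, 2 * b, N * c)})
    = bqf_equiv (4 * k) `` {(a * N, 2 * b, c)}"
proof -
  let ?E = "bqf_equiv (4 * k)"
  have E: "equiv (primitive_forms (4 * k)) ?E" by (rule equiv_bqf_equiv)
  have "((a, 2 * b, N * c), (a, 2 * b, N * c)) \<in> ?E" using E f by (meson equivE refl_onD)
  moreover have "?E `` {(a' * N, 2 * b', c')} = ?E `` {(a * N, 2 * b, c)}"
    if "((a, 2 * b, N * c), (a', 2 * b', N * c')) \<in> ?E" "N dvd b' - \<beta>" for a' b' c'
    using compose_step_respects[OF N b that(2,1)] equiv_class_eq[OF E] by blast
  ultimately show ?thesis using b unfolding compose_step_def by blast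
qed

text \<open>With \<open>N ^ n\<close> in the last coefficient the same \<open>b\<close> serves all
  \<open>n\<close> steps, each of which moves one factor \<open>N\<close> to the front.\<close>

lemma compose_step_funpow:
  assumes N: "N \<noteq> 0" "odd N" "coprime N k" "N dvd \<beta>\<^sup>2 - k" and b: "N dvd b - \<beta>"
    and f: "(a, 2 * b, N ^ n * c) \<in> primitive_forms (4 * k)"
  shows "(compose_step k N \<beta> ^^ n) (bqf_equiv (4 * k) `` {(a, 2 * b, N ^ n * c)})
    = bqf_equiv (4 * k) `` {(a * N ^ n, 2 * b, c)}"
  using f
proof (induction n arbitrary: a)
  case (Suc n)
  have f: "(a, 2 * b, N * (N ^ n * c)) \<in> primitive_forms (4 * k)" using Suc.prems by (simp add: mult.assoc)
  have "(compose_step k N \<beta> ^^ Suc n) (bqf_equiv (4 * k) `` {(a, 2 * b, N ^ Suc n * c)})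
     = (compose_step k N \<beta> ^^ n) (bqf_equiv (4 * k) `` {(a * N, 2 * b, N ^ n * c)})"
    using compose_step_class[OF N b f] by (simp add: funpow_swap1 mult.assoc)
  also have "\<dots> = bqf_equiv (4 * k) `` {(a * N * N ^ n, 2 * b, c)}"
    by (rule Suc.IH) (rule compose_step_primitive[OF N(2-4) b f])
  finally show ?case by (simp add: mult.assoc)
qed simp

text \<open>The matrix is multiplication by \<open>x + K * sqrt k\<close> on the lattice spanned by \<open>a\<close> and \<open>b + sqrt k\<close>.\<close>

lemma principal_composition:
  fixes a b c x K M k :: int
  assumes "x\<^sup>2 - k * K\<^sup>2 = M" "M \<noteq> 0" "M dvd x - K * b" "b\<^sup>2 - a * (M * c) = k"
  shows "\<exists>p q r s. represents_via (a * M, 2 * b, c) (a, 2 * b, M * c) p q r s"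
proof -
  obtain p where p: "x - K * b = M * p" using assms(3) by blast
  have "M * (p * (x + K * b) - (- K * c) * (a * K)) = (x - K * b) * (x + K * b) + a * M * c * K\<^sup>2"
    unfolding p by (simp add: algebra_simps power2_eq_square)
  also have "\<dots> = x\<^sup>2 - (b\<^sup>2 - a * (M * c)) * K\<^sup>2" by (simp add: algebra_simps power2_eq_square)
  also have "\<dots> = M" unfolding assms(4) by (rule assms(1))
  finally have det: "p * (x + K * b) - (- K * c) * (a * K) = 1" using assms(2) by simp
  have s: "x + K * b = M * p + 2 * K * b" using p by simp
  have d: "p * (M * p + 2 * K * b) + K * c * a * K = 1" using det unfolding s by simp
  have "represents_via (a * M, 2 * b, c) (a, 2 * b, M * c) p (- K * c) (a * K) (M * p + 2 * K * b)"
    unfolding represents_via_iff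
  proof (intro conjI)
    show "p * (M * p + 2 * K * b) - - K * c * (a * K) = 1" using d by simp
    have "a * M * p\<^sup>2 + 2 * b * p * (a * K) + c * (a * K)\<^sup>2 = a * (p * (M * p + 2 * K * b) + K * c * a * K)"
      by (simp add: algebra_simps power2_eq_square)
    then show "a = a * M * p\<^sup>2 + 2 * b * p * (a * K) + c * (a * K)\<^sup>2" unfolding d by simp
    have "2 * (a * M) * p * (- K * c) + 2 * b * (p * (M * p + 2 * K * b) + - K * c * (a * K))
        + 2 * c * (a * K) * (M * p + 2 * K * b) = 2 * b * (p * (M * p + 2 * K * b) + K * c * a * K)"
      by (simp add: algebra_simps power2_eq_square)
    then show "2 * b = 2 * (a * M) * p * (- K * c) + 2 * b * (p * (M * p + 2 * K * b) + - K * c * (a * K))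
        + 2 * c * (a * K) * (M * p + 2 * K * b)" unfolding d by simp
    have "a * M * (- K * c)\<^sup>2 + 2 * b * (- K * c) * (M * p + 2 * K * b) + c * (M * p + 2 * K * b)\<^sup>2
        = M * c * (p * (M * p + 2 * K * b) + K * c * a * K)"
      by (simp add: algebra_simps power2_eq_square)
    then show "M * c = a * M * (- K * c)\<^sup>2 + 2 * b * (- K * c) * (M * p + 2 * K * b) + c * (M * p + 2 * K * b)\<^sup>2"
      unfolding d by simp
  qed
  then show ?thesis by blast
qed

text \<open>Converse of \<open>principal_composition\<close> for \<open>M = N\<close>: the matrix of
  such an equivalence is forced to be multiplication by some \<open>u + v * sqrt k\<close>, and
  determinant 1 says that this element has norm \<open>N\<close>.\<close>

lemma fixed_class_norm:
  fixes a b c N k \<beta> :: int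
  assumes "N \<noteq> 0" "N dvd b - \<beta>" and g: "(a * N, 2 * b, c) \<in> primitive_forms (4 * k)"
    and *: "represents_via (a * N, 2 * b, c) (a, 2 * b, N * c) p q r s"
  obtains u v where "u\<^sup>2 - k * v\<^sup>2 = N" "coprime u v" "N dvd u - v * \<beta>"
proof -
  have det: "p * s - q * r = 1" and e1: "a = a * N * p\<^sup>2 + 2 * b * p * r + c * r\<^sup>2"
    and e2: "b = a * N * p * q + b * (p * s + q * r) + c * r * s"
    and e3: "N * c = a * N * q\<^sup>2 + 2 * b * q * s + c * s\<^sup>2"
    using * unfolding represents_via_iff by auto
  have k: "b\<^sup>2 - a * N * c = k" and prim: "bqf_primitive (a * N, 2 * b, c)"
    using g unfolding primitive_forms_even_iff by auto
  \<comment> \<open>Applying the inverse matrix turns the quadratic conditions into linear ones in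
    \<open>p\<close>, \<open>q\<close>, \<open>r\<close>, \<open>s\<close>.\<close>
  have "s * a - r * b = (p * s - q * r) * (a * N * p + b * r)"
    by (subst (1) e1, subst (2) e2) (simp add: algebra_simps power2_eq_square)
  then have 1: "(s - N * p) * a = r * (2 * b)" unfolding det by (simp add: algebra_simps)
  have "s * b - r * (N * c) = (p * s - q * r) * (a * N * q + b * s)"
    unfolding e3 by (subst (1) e2) (simp add: algebra_simps power2_eq_square)
  then have "N * (a * q) = N * (- (r * c))" unfolding det by (simp add: algebra_simps)
  then have 2: "a * q = - (r * c)" using assms(1) mult_left_cancel by blast
  have "- q * b + p * (N * c) = (p * s - q * r) * (b * q + c * s)"
    unfolding e3 by (subst (1) e2) (simp add: algebra_simps power2_eq_square)
  then have 3: "(s - N * p) * (- c) = q * (2 * b)" unfolding det by (simp add: algebra_simps)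
  have unit: "is_unit d" if "d dvd 2 * b" "d dvd a" "d dvd - c" for d
    using that prim unfolding bqf_primitive_iff by auto
  have 4: "r * (- c) = q * a" using 2 by (simp add: algebra_simps)
  obtain v where v: "s - N * p = v * (2 * b)" "r = v * a" "q = v * (- c)"
    using primitive_proportional[OF unit 1 3 4] by blast
  define u where "u = s - b * v"
  have s: "s = u + b * v" and Np: "N * p = u - b * v" using v(1) by (simp_all add: u_def algebra_simps)
  have "N = N * (p * s - q * r)" unfolding det by simp
  also have "\<dots> = (N * p) * s + N * a * c * v\<^sup>2" unfolding v(2,3) by (simp add: algebra_simps power2_eq_square)
  also have "\<dots> = u\<^sup>2 - (b\<^sup>2 - a * N * c) * v\<^sup>2" unfolding Np s by (simp add: algebra_simps power2_eq_square)
  finally have "u\<^sup>2 - k * v\<^sup>2 = N" unfolding k by simp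
  moreover have "coprime u v"
  proof (rule coprimeI)
    fix d assume "d dvd u" "d dvd v"
    then have "d dvd p * s - q * r" unfolding s v(2) by simp
    then show "is_unit d" unfolding det .
  qed
  moreover have "u - v * \<beta> = N * p + v * (b - \<beta>)" unfolding Np by (simp add: algebra_simps)
  then have "N dvd u - v * \<beta>" using assms(2) by simp
  ultimately show thesis by (rule that)
qed

lemma norm_power_dichotomy:
  fixes k N x K :: int
  assumes N: "N \<noteq> 0" "odd N" "coprime N k" and "prime n"
    and norm: "x\<^sup>2 - k * K\<^sup>2 = N ^ n" and \<beta>: "N ^ n dvd \<beta>\<^sup>2 - k" "N ^ n dvd x - K * \<beta>"
  shows "(\<exists>u v. u\<^sup>2 - k * v\<^sup>2 = N \<and> coprime u v \<and> N dvd u - v * \<beta>) \<or> n dvd class_number (4 * k)"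
proof (rule disjCI)
  assume no: "\<not> n dvd class_number (4 * k)"
  let ?E = "bqf_equiv (4 * k)" and ?P = "primitive_forms (4 * k)"
  let ?T = "compose_step k N \<beta>"
  have E: "equiv ?P ?E" by (rule equiv_bqf_equiv)
  have "n > 0" using assms(4) by (rule prime_gt_0_nat)
  then have Nn: "N dvd N ^ n" by simp
  note N' = N dvd_trans[OF Nn \<beta>(1)]
  have fin: "finite (?P // ?E)" using no unfolding class_number_def by (metis card.infinite dvd_0_right)
  \<comment> \<open>Divisibility by the full power \<open>N ^ n\<close> is arranged at once, so that
    one representative covers a whole period.\<close>
  have rep: "\<exists>a b c. C = ?E `` {(a, 2 * b, N ^ n * c)} \<and> N ^ n dvd b - \<beta> \<and> (a, 2 * b, N ^ n * c) \<in> ?P"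
    if C: "C \<in> ?P // ?E" for C
  proof -
    obtain f where f: "f \<in> ?P" "C = ?E `` {f}" using C unfolding quotient_def by blast
    obtain a b c where g: "(f, (a, 2 * b, N ^ n * c)) \<in> ?E" "N ^ n dvd b - \<beta>"
      using divisible_representative[OF _ \<beta>(1) f(1)] N(1) by (metis power_not_zero)
    then show ?thesis using f equiv_class_eq[OF E g(1)] unfolding bqf_equiv_iff by blast
  qed
  have step: "\<exists>a b c. C = ?E `` {(a, 2 * b, N * c)} \<and> N dvd b - \<beta> \<and> (a, 2 * b, N * c) \<in> ?P
      \<and> ?T C = ?E `` {(a * N, 2 * b, c)} \<and> (a * N, 2 * b, c) \<in> ?P"
    if C: "C \<in> ?P // ?E" for C
  proof -
    obtain a b c where abc: "C = ?E `` {(a, 2 * b, N ^ n * c)}" "N ^ n dvd b - \<beta>" "(a, 2 * b, N ^ n * c) \<in> ?P"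
      using rep[OF C] by blast
    have "N ^ n * c = N * (N ^ (n - 1) * c)" using \<open>n > 0\<close> by (simp add: power_eq_if)
    then show ?thesis
      using abc dvd_trans[OF Nn abc(2)] compose_step_class[OF N', of b a "N ^ (n - 1) * c"]
        compose_step_primitive[OF N'(2-4), of b a "N ^ (n - 1) * c"]
      by metis
  qed
  have "\<exists>C\<in>?P // ?E. ?T C = C"
  proof (rule ccontr)
    assume free: "\<not> ?thesis"
    have "n dvd card (?P // ?E)"
    proof (rule prime_period_dvd_card[of _ _ ?T])
      fix C assume C: "C \<in> ?P // ?E"
      show "?T C \<in> ?P // ?E" using step[OF C] by (metis quotientI)
      show "?T C \<noteq> C" using free C by blast
      obtain a b c where abc: "C = ?E `` {(a, 2 * b, N ^ n * c)}" "N ^ n dvd b - \<beta>" "(a, 2 * b, N ^ n * c) \<in> ?P"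
        using rep[OF C] by blast
      have T: "(?T ^^ n) C = ?E `` {(a * N ^ n, 2 * b, c)}"
        unfolding abc(1) by (rule compose_step_funpow[OF N' dvd_trans[OF Nn abc(2)] abc(3)])
      have "x - K * b = (x - K * \<beta>) - K * (b - \<beta>)" by (simp add: algebra_simps)
      then have "N ^ n dvd x - K * b" using \<beta>(2) abc(2) by (metis dvd_diff dvd_mult)
      then obtain p q r s where pr: "represents_via (a * N ^ n, 2 * b, c) (a, 2 * b, N ^ n * c) p q r s"
        using principal_composition[OF norm, of b a c] N(1) abc(3) unfolding primitive_forms_even_iff by auto
      then have "(a * N ^ n, 2 * b, c) \<in> ?P"
        using represents_via_primitive_forms[OF represents_via_inverse abc(3)] by blast
      then have "((a * N ^ n, 2 * b, c), (a, 2 * b, N ^ n * c)) \<in> ?E"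
        using pr abc(3) unfolding bqf_equiv_iff by blast
      then have "?E `` {(a * N ^ n, 2 * b, c)} = C" unfolding abc(1) by (rule equiv_class_eq[OF E])
      then show "(?T ^^ n) C = C" unfolding T .
    qed (use fin assms(4) in auto)
    then show False using no by (simp add: class_number_def)
  qed
  then obtain C where C: "C \<in> ?P // ?E" "?T C = C" by blast
  obtain a b c where abc: "C = ?E `` {(a, 2 * b, N * c)}" "N dvd b - \<beta>" "(a, 2 * b, N * c) \<in> ?P"
     "?T C = ?E `` {(a * N, 2 * b, c)}" "(a * N, 2 * b, c) \<in> ?P"
    using step[OF C(1)] by blast
  have "((a * N, 2 * b, c), (a, 2 * b, N * c)) \<in> ?E"
    using C(2) abc eq_equiv_class[OF _ E] by metis
  then obtain p q r s where "represents_via (a * N, 2 * b, c) (a, 2 * b, N * c) p q r s"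
    unfolding bqf_equiv_iff by blast
  then show "\<exists>u v. u\<^sup>2 - k * v\<^sup>2 = N \<and> coprime u v \<and> N dvd u - v * \<beta>"
    using fixed_class_norm[OF N(1) abc(2,5)] by metis
qed

section \<open>Normalisation by units\<close>

text \<open>Sending \<open>sqrt k\<close> to \<open>- \<beta>\<close> is a ring homomorphism modulo
  \<open>M\<close>, because \<open>\<beta>\<^sup>2\<close> is congruent to \<open>k\<close>; so it
  commutes with powers.\<close>

lemma pell_power:
  fixes u v k \<beta> M :: int
  assumes "M dvd \<beta>\<^sup>2 - k" and k: "k \<ge> 0"
  shows "\<exists>U V. U\<^sup>2 - k * V\<^sup>2 = (u\<^sup>2 - k * v\<^sup>2) ^ n \<and> M dvd (U - V * \<beta>) - (u - v * \<beta>) ^ n \<and>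
    (real_of_int u + real_of_int v * sqrt (real_of_int k)) ^ n = real_of_int U + real_of_int V * sqrt (real_of_int k)"
proof (induction n)
  case 0
  show ?case by (intro exI[of _ 1] exI[of _ 0]) simp
next
  case (Suc n)
  then obtain U V where UV: "U\<^sup>2 - k * V\<^sup>2 = (u\<^sup>2 - k * v\<^sup>2) ^ n" "M dvd (U - V * \<beta>) - (u - v * \<beta>) ^ n"
    "(real_of_int u + real_of_int v * sqrt (real_of_int k)) ^ n = real_of_int U + real_of_int V * sqrt (real_of_int k)"
    by blast
  have "(u * U + k * v * V)\<^sup>2 - k * (u * V + v * U)\<^sup>2 = (u\<^sup>2 - k * v\<^sup>2) * (U\<^sup>2 - k * V\<^sup>2)"
    by (simp add: algebra_simps power2_eq_square)
  then have 1: "(u * U + k * v * V)\<^sup>2 - k * (u * V + v * U)\<^sup>2 = (u\<^sup>2 - k * v\<^sup>2) ^ Suc n"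
    unfolding UV(1) by simp
  have "((u * U + k * v * V) - (u * V + v * U) * \<beta>) - (u - v * \<beta>) ^ Suc n
     = (u - v * \<beta>) * ((U - V * \<beta>) - (u - v * \<beta>) ^ n) - (v * V) * (\<beta>\<^sup>2 - k)"
    by (simp add: algebra_simps power2_eq_square)
  then have 2: "M dvd ((u * U + k * v * V) - (u * V + v * U) * \<beta>) - (u - v * \<beta>) ^ Suc n"
    using UV(2) assms(1) by (metis dvd_diff dvd_mult)
  have 3: "(real_of_int u + real_of_int v * sqrt (real_of_int k)) ^ Suc n
    = real_of_int (u * U + k * v * V) + real_of_int (u * V + v * U) * sqrt (real_of_int k)"
    unfolding power_Suc UV(3) using k by (simp add: algebra_simps)
  show ?case using 1 2 3 by blast
qed

text \<open>The associate \<open>X0 + Y0 * sqrt k\<close> with the smallest \<open>\<bar>Y0\<bar>\<close> is taken. Minimality against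
  multiplication by the fundamental unit gives the last inequality with \<open>\<le>\<close>; equality
  would force \<open>M dvd 2 * X\<close>.\<close>

lemma least_associate:
  fixes k u v M u1 v1 :: int
  assumes k: "k > 1" and M: "M < - 1" "odd M" "coprime M k"
    and uv: "u\<^sup>2 - k * v\<^sup>2 = M" "coprime u v"
    and pell: "u1 > 0" "v1 > 0" "u1\<^sup>2 - k * v1\<^sup>2 = 1"
  obtains X Y l w w' :: int where "X > 0" "Y > 0" "l \<in> {1, -1}" "w\<^sup>2 - k * w'\<^sup>2 = 1"
    "X\<^sup>2 - k * Y\<^sup>2 = M" "coprime X Y" "X * v1 < Y * (u1 - 1)"
    "u = X * w + k * (l * Y) * w'" "v = X * w' + l * Y * w"
proof -
  \<comment> \<open>The pairs \<open>(X, Y)\<close> for which \<open>u + v * sqrt k\<close> is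
    \<open>X + Y * sqrt k\<close> times a unit of norm 1.\<close>
  define S where "S = (\<lambda>(X, Y). \<exists>w w' :: int. w\<^sup>2 - k * w'\<^sup>2 = 1 \<and> u = X * w + k * Y * w' \<and> v = X * w' + Y * w)"
  have "S (u, v)" unfolding S_def prod.case by (intro exI[of _ 1] exI[of _ 0]) simp
  then obtain P where P: "S P" and least: "\<And>Q. S Q \<Longrightarrow> nat \<bar>snd P\<bar> \<le> nat \<bar>snd Q\<bar>"
    using ex_has_least_nat[of S "(u, v)" "\<lambda>Q. nat \<bar>snd Q\<bar>"] by blast
  obtain X0 Y0 where P0: "P = (X0, Y0)" by (cases P)
  obtain w w' where w: "w\<^sup>2 - k * w'\<^sup>2 = 1" and u: "u = X0 * w + k * Y0 * w'" and v: "v = X0 * w' + Y0 * w"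
    using P unfolding P0 S_def by auto
  have "u\<^sup>2 - k * v\<^sup>2 = (X0\<^sup>2 - k * Y0\<^sup>2) * (w\<^sup>2 - k * w'\<^sup>2)"
    unfolding u v by (simp add: algebra_simps power2_eq_square)
  then have norm0: "X0\<^sup>2 - k * Y0\<^sup>2 = M" unfolding uv(1) w by simp
  have cop0: "coprime X0 Y0"
  proof (rule coprimeI)
    fix d assume "d dvd X0" "d dvd Y0"
    then have "d dvd u" "d dvd v" unfolding u v by simp_all
    then show "is_unit d" using uv(2) coprime_common_divisor by blast
  qed
  have "Y0 \<noteq> 0"
  proof
    assume "Y0 = 0"
    then have "X0\<^sup>2 = M" using norm0 by simp
    then show False using M(1) zero_le_power2[of X0] by linarith
  qed
  have "X0 \<noteq> 0"
  proof
    assume "X0 = 0"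
    then have "k dvd M" using norm0 by auto
    then have "is_unit k" using coprime_common_divisor[OF M(3), of k] by simp
    then show False using k by simp
  qed
  define X Y where "X = \<bar>X0\<bar>" and "Y = \<bar>Y0\<bar>"
  \<comment> \<open>\<open>X0\<close> and \<open>Y0\<close> are \<open>X\<close> and
    \<open>l * Y\<close> up to the common sign \<open>sgn X0\<close>, which is finally absorbed into
    the unit.\<close>
  define l where "l = sgn X0 * sgn Y0"
  have pos: "X > 0" "Y > 0" using \<open>X0 \<noteq> 0\<close> \<open>Y0 \<noteq> 0\<close> by (auto simp: X_def Y_def)
  have norm: "X\<^sup>2 - k * Y\<^sup>2 = M" using norm0 by (simp add: X_def Y_def)
  have cop: "coprime X Y" using cop0 by (simp add: X_def Y_def)
  have l: "l \<in> {1, -1}" using \<open>X0 \<noteq> 0\<close> \<open>Y0 \<noteq> 0\<close> by (auto simp: l_def sgn_if)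
  have ss: "sgn X0 * sgn X0 = 1" "l * l = 1" using \<open>X0 \<noteq> 0\<close> l by (auto simp: sgn_if)
  have X0: "X0 = sgn X0 * X" by (simp add: X_def mult.commute abs_mult_sgn)
  have Y0: "Y0 = sgn X0 * (l * Y)" using ss(1) unfolding l_def Y_def
    by (metis abs_mult_sgn mult.assoc mult.commute mult_1)
  have step: "Y \<le> \<bar>Y * u1 - X * v1\<bar>"
  proof -
    \<comment> \<open>The minimal element is multiplied by \<open>u1 - l * v1 * sqrt k\<close>, and
      the unit by its inverse. The sign \<open>l\<close> makes the two terms of \<open>Y'\<close>
      work against each other.\<close>
    define X' Y' where "X' = u1 * X0 - k * (l * v1) * Y0" and "Y' = u1 * Y0 - l * v1 * X0"
    define z z' where "z = u1 * w + k * (l * v1) * w'" and "z' = u1 * w' + l * v1 * w"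
    have lv: "u1\<^sup>2 - k * (l * v1)\<^sup>2 = 1" using pell(3) l by auto
    have "z\<^sup>2 - k * z'\<^sup>2 = (u1\<^sup>2 - k * (l * v1)\<^sup>2) * (w\<^sup>2 - k * w'\<^sup>2)"
      unfolding z_def z'_def by (simp add: algebra_simps power2_eq_square)
    then have "z\<^sup>2 - k * z'\<^sup>2 = 1" unfolding lv w by simp
    moreover have "X' * z + k * Y' * z' = (u1\<^sup>2 - k * (l * v1)\<^sup>2) * (X0 * w + k * Y0 * w')"
      unfolding X'_def Y'_def z_def z'_def by (simp add: algebra_simps power2_eq_square)
    then have "u = X' * z + k * Y' * z'" unfolding lv u by simp
    moreover have "X' * z' + Y' * z = (u1\<^sup>2 - k * (l * v1)\<^sup>2) * (X0 * w' + Y0 * w)"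
      unfolding X'_def Y'_def z_def z'_def by (simp add: algebra_simps power2_eq_square)
    then have "v = X' * z' + Y' * z" unfolding lv v by simp
    ultimately have "S (X', Y')" unfolding S_def by auto
    from least[OF this] have "\<bar>Y0\<bar> \<le> \<bar>Y'\<bar>" unfolding P0 by simp
    moreover have "Y' = sgn X0 * l * (Y * u1 - X * v1)"
      unfolding Y'_def by (subst X0, subst Y0) (simp add: algebra_simps)
    then have "\<bar>Y'\<bar> = \<bar>Y * u1 - X * v1\<bar>" using \<open>X0 \<noteq> 0\<close> l by (auto simp: abs_mult abs_sgn_eq)
    ultimately show ?thesis by (simp add: Y_def)
  qed
  have "(X * v1)\<^sup>2 < (Y * u1)\<^sup>2"
  proof -
    have "(X * v1)\<^sup>2 = (k * Y\<^sup>2 + M) * v1\<^sup>2" using norm by (simp add: power_mult_distrib)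
    also have "\<dots> < (k * Y\<^sup>2) * v1\<^sup>2" using M(1) pell(2) by (intro mult_strict_right_mono) auto
    also have "\<dots> = (u1\<^sup>2 - 1) * Y\<^sup>2" using pell(3) by (simp add: algebra_simps)
    also have "\<dots> < (Y * u1)\<^sup>2" using pos by (simp add: algebra_simps power_mult_distrib)
    finally show ?thesis .
  qed
  then have "X * v1 < Y * u1" by (rule power2_less_imp_less) (use pos pell in simp)
  then have le: "X * v1 \<le> Y * (u1 - 1)" using step by (simp add: algebra_simps)
  have "X * v1 \<noteq> Y * (u1 - 1)"
  proof
    assume eq: "X * v1 = Y * (u1 - 1)"
    then have "Y dvd X * v1" by simp
    then have "Y dvd v1" using cop by (meson coprime_commute coprime_dvd_mult_right_iff)
    then obtain t where t: "v1 = Y * t" by blast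
    have "t \<noteq> 0" using t pell(2) by auto
    have "Y * (X * t) = Y * (u1 - 1)" using eq unfolding t by (simp add: algebra_simps)
    then have u1: "u1 = X * t + 1" using pos(2) by simp
    have "t * (t * M + 2 * X) = u1\<^sup>2 - k * v1\<^sup>2 - 1"
      unfolding u1 t norm[symmetric] by (simp add: algebra_simps power2_eq_square)
    then have "t * (t * M + 2 * X) = 0" using pell(3) by simp
    then have "t * M + 2 * X = 0" using \<open>t \<noteq> 0\<close> by simp
    then have "2 * X = M * (- t)" by (simp add: mult.commute)
    then have "M dvd 2 * X" by simp
    then have MX: "M dvd X" using M(2) by (simp add: coprime_dvd_mult_right_iff)
    have "k * Y\<^sup>2 = X * X - M" using norm by (simp add: power2_eq_square)
    then have "M dvd k * Y\<^sup>2" using MX by simp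
    then have "M dvd Y\<^sup>2" using M(3) by (simp add: coprime_dvd_mult_right_iff)
    moreover have "coprime M (Y\<^sup>2)" using cop MX by (meson coprime_divisors coprime_power_right_iff dvd_refl)
    ultimately have "is_unit M" using coprime_common_divisor[of M "Y\<^sup>2" M] by simp
    then show False using M(1) by auto
  qed
  with le have lt: "X * v1 < Y * (u1 - 1)" by simp
  have w2: "(sgn X0 * w)\<^sup>2 - k * (sgn X0 * w')\<^sup>2 = 1" using w \<open>X0 \<noteq> 0\<close> by (auto simp: sgn_if)
  have u2: "u = X * (sgn X0 * w) + k * (l * Y) * (sgn X0 * w')"
    unfolding u by (subst (1) X0, subst (1) Y0) (simp add: algebra_simps)
  have v2: "v = X * (sgn X0 * w') + l * Y * (sgn X0 * w)"
    unfolding v by (subst (1) X0, subst (1) Y0) (simp add: algebra_simps)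
  show thesis by (rule that[OF pos l w2 norm cop lt u2 v2])
qed

text \<open>The norm is negative, so the denominator of \<open>Q\<close> is negative. Once it is
  cleared, the upper bound splits into a rational part and a multiple of \<open>sqrt k\<close>, and
  \<open>lt\<close> controls both.\<close>

lemma conjugate_quotient_bounds:
  fixes k X Y u1 v1 :: int
  assumes "k > 1" "X > 0" "Y > 0" "X\<^sup>2 - k * Y\<^sup>2 < 0"
    and pell: "u1 > 0" "v1 > 0" "u1\<^sup>2 - k * v1\<^sup>2 = 1" and lt: "X * v1 < Y * (u1 - 1)"
  defines "Q \<equiv> \<bar>(real_of_int X + real_of_int Y * sqrt (real_of_int k)) /
        (real_of_int X - real_of_int Y * sqrt (real_of_int k))\<bar>"
  shows "1 < Q" "Q < real_of_int u1 + real_of_int v1 * sqrt (real_of_int k)"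
proof -
  define s where "s = sqrt (real_of_int k)"
  have s: "s > 0" "s * s = real_of_int k" using assms(1) by (simp_all add: s_def)
  have "real_of_int (X\<^sup>2) < real_of_int (k * Y\<^sup>2)" using assms(4) by linarith
  moreover have "(real_of_int Y * s)\<^sup>2 = real_of_int Y ^ 2 * (s * s)" by (simp add: power2_eq_square)
  ultimately have "(real_of_int X)\<^sup>2 < (real_of_int Y * s)\<^sup>2" unfolding s(2) by (simp add: mult.commute)
  then have B: "real_of_int X < real_of_int Y * s"
    by (rule power2_less_imp_less) (use assms s in simp)
  have "real_of_int X + real_of_int Y * s > 0" using assms s by (simp add: add_pos_pos)
  then have Q: "Q = (real_of_int X + real_of_int Y * s) / (real_of_int Y * s - real_of_int X)"
    unfolding Q_def s_def[symmetric] using B by (simp add: abs_divide)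
  show "1 < Q" unfolding Q using B assms(2) by (simp add: less_divide_eq)
  \<comment> \<open>Multiplying by \<open>v1\<close> brings in
    \<open>(u1 - 1) * (u1 + 1) = k * v1\<^sup>2\<close>.\<close>
  have "v1 * (X * (1 + u1)) = (X * v1) * (1 + u1)" by (simp only: mult_ac)
  also have "\<dots> \<le> (Y * (u1 - 1)) * (1 + u1)" using lt pell(1) by (intro mult_right_mono) auto
  also have "\<dots> = v1 * (k * v1 * Y)" using pell(3) by (simp add: algebra_simps power2_eq_square)
  finally have 1: "X * (1 + u1) \<le> k * v1 * Y" using pell(2) by simp
  have "s * real_of_int (Y - u1 * Y + v1 * X) < 0"
  proof (rule mult_pos_neg[OF s(1)])
    have "Y - u1 * Y + v1 * X < 0" using lt by (simp add: algebra_simps)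
    then show "real_of_int (Y - u1 * Y + v1 * X) < 0" by (simp only: of_int_less_0_iff)
  qed
  moreover have "real_of_int (X * (1 + u1) - k * v1 * Y) \<le> 0" using 1 by (simp only: of_int_le_0_iff diff_le_0_iff_le)
  moreover have "real_of_int X + real_of_int Y * s - (real_of_int u1 + real_of_int v1 * s) * (real_of_int Y * s - real_of_int X)
     = real_of_int (X * (1 + u1) - k * v1 * Y) + s * real_of_int (Y - u1 * Y + v1 * X)"
    using s(2) by (simp add: algebra_simps)
  ultimately have "real_of_int X + real_of_int Y * s < (real_of_int u1 + real_of_int v1 * s) * (real_of_int Y * s - real_of_int X)"
    by linarith
  then show "Q < real_of_int u1 + real_of_int v1 * sqrt (real_of_int k)"
    unfolding Q s_def[symmetric] using B by (simp add: divide_less_eq)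
qed

section \<open>Comparison of two elements of norm \<open>N ^ n\<close>\<close>

lemma mult_sqrt_coeffs:
  fixes a b c d k :: int
  assumes "k \<ge> 0"
  shows "(real_of_int a + real_of_int b * sqrt (real_of_int k)) * (real_of_int c + real_of_int d * sqrt (real_of_int k))
    = real_of_int (a * c + k * b * d) + real_of_int (a * d + b * c) * sqrt (real_of_int k)"
  using assms by (simp add: algebra_simps)

text \<open>Modulo \<open>N ^ n\<close>, the conjugate of \<open>(u + v * sqrt k) ^ n\<close> is killed by \<open>sqrt k \<mapsto> \<beta>\<close>, so it
  lies in the same ideal as the conjugate of \<open>x + K * sqrt k\<close>; hence the quotient is integral.\<close>

lemma power_associate:
  fixes x K u v k \<beta> N :: int
  assumes "N \<noteq> 0" "k \<ge> 0" and norm: "x\<^sup>2 - k * K\<^sup>2 = N ^ n" and \<beta>: "N ^ n dvd \<beta>\<^sup>2 - k" "N ^ n dvd x - K * \<beta>"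
    and uv: "u\<^sup>2 - k * v\<^sup>2 = N" "N dvd u - v * \<beta>"
  obtains w w' where "w\<^sup>2 - k * w'\<^sup>2 = 1"
    "real_of_int x + real_of_int K * sqrt (real_of_int k)
      = (real_of_int u + real_of_int v * sqrt (real_of_int k)) ^ n * (real_of_int w + real_of_int w' * sqrt (real_of_int k))"
proof -
  obtain U V where UV: "U\<^sup>2 - k * V\<^sup>2 = N ^ n" "N ^ n dvd (U - V * \<beta>) - (u - v * \<beta>) ^ n"
    "(real_of_int u + real_of_int v * sqrt (real_of_int k)) ^ n = real_of_int U + real_of_int V * sqrt (real_of_int k)"
    using pell_power[OF \<beta>(1) assms(2), of u v n] unfolding uv(1) by blast
  have "N ^ n dvd (u - v * \<beta>) ^ n" using uv(2) by (rule dvd_power_same)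
  then have UV2: "N ^ n dvd U - V * \<beta>" using UV(2) by (metis dvd_add diff_add_cancel)
  define M where "M = N ^ n"
  have "M \<noteq> 0" using assms(1) by (simp add: M_def)
  \<comment> \<open>\<open>M * w\<close> and \<open>M * w'\<close> are the coordinates of
    \<open>x + K * sqrt k\<close> times the conjugate of \<open>U + V * sqrt k\<close>.\<close>
  have "x * U - k * K * V = (x - K * \<beta>) * U + K * \<beta> * (U - V * \<beta>) + K * V * (\<beta>\<^sup>2 - k)"
    by (simp add: algebra_simps power2_eq_square)
  then have "M dvd x * U - k * K * V" using \<beta> UV2 unfolding M_def by (metis dvd_add dvd_mult dvd_mult2)
  then obtain w where w: "x * U - k * K * V = M * w" by blast
  have "K * U - x * V = K * (U - V * \<beta>) - V * (x - K * \<beta>)" by (simp add: algebra_simps)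
  then have "M dvd K * U - x * V" using \<beta> UV2 unfolding M_def by (metis dvd_diff dvd_mult)
  then obtain w' where w': "K * U - x * V = M * w'" by blast
  have "M * M * (w\<^sup>2 - k * w'\<^sup>2) = (M * w)\<^sup>2 - k * (M * w')\<^sup>2" by (simp add: algebra_simps power2_eq_square)
  also have "\<dots> = (x\<^sup>2 - k * K\<^sup>2) * (U\<^sup>2 - k * V\<^sup>2)"
    unfolding w[symmetric] w'[symmetric] by (simp add: algebra_simps power2_eq_square)
  also have "\<dots> = M * M" unfolding norm UV(1) M_def ..
  finally have "w\<^sup>2 - k * w'\<^sup>2 = 1" using \<open>M \<noteq> 0\<close> by simp
  moreover have "M * (U * w + k * V * w') = U * (M * w) + k * V * (M * w')" by (simp add: algebra_simps)
  then have "M * (U * w + k * V * w') = x * (U\<^sup>2 - k * V\<^sup>2)"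
    unfolding w[symmetric] w'[symmetric] by (simp add: algebra_simps power2_eq_square)
  then have x: "U * w + k * V * w' = x" unfolding UV(1) M_def[symmetric] using \<open>M \<noteq> 0\<close> by simp
  have "M * (U * w' + V * w) = U * (M * w') + V * (M * w)" by (simp add: algebra_simps)
  then have "M * (U * w' + V * w) = K * (U\<^sup>2 - k * V\<^sup>2)"
    unfolding w[symmetric] w'[symmetric] by (simp add: algebra_simps power2_eq_square)
  then have K: "U * w' + V * w = K" unfolding UV(1) M_def[symmetric] using \<open>M \<noteq> 0\<close> by simp
  have "real_of_int x + real_of_int K * sqrt (real_of_int k)
      = (real_of_int u + real_of_int v * sqrt (real_of_int k)) ^ n * (real_of_int w + real_of_int w' * sqrt (real_of_int k))"
    unfolding UV(3) mult_sqrt_coeffs[OF assms(2)] x K ..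
  ultimately show thesis by (rule that)
qed

lemma normalized_associate:
  fixes k u v M u1 v1 :: int
  assumes k: "k > 1" and M: "M < - 1" "odd M" "coprime M k"
    and uv: "u\<^sup>2 - k * v\<^sup>2 = M" "coprime u v"
    and pell: "u1 > 0" "v1 > 0" "u1\<^sup>2 - k * v1\<^sup>2 = 1"
  obtains X Y l w w' :: int where "X > 0" "Y > 0" "l \<in> {1, -1}" "w\<^sup>2 - k * w'\<^sup>2 = 1"
    "X\<^sup>2 - k * Y\<^sup>2 = M" "gcd X Y = 1"
    "1 < \<bar>(real_of_int X + real_of_int Y * sqrt (real_of_int k)) /
            (real_of_int X - real_of_int Y * sqrt (real_of_int k))\<bar>"
    "\<bar>(real_of_int X + real_of_int Y * sqrt (real_of_int k)) /
        (real_of_int X - real_of_int Y * sqrt (real_of_int k))\<bar>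
         < real_of_int u1 + real_of_int v1 * sqrt (real_of_int k)"
    "real_of_int u + real_of_int v * sqrt (real_of_int k) =
       (real_of_int X + real_of_int l * real_of_int Y * sqrt (real_of_int k)) *
       (real_of_int w + real_of_int w' * sqrt (real_of_int k))"
proof -
  obtain X Y l w w' where *: "X > 0" "Y > 0" "l \<in> {1, -1}" "w\<^sup>2 - k * w'\<^sup>2 = 1"
    "X\<^sup>2 - k * Y\<^sup>2 = M" "coprime X Y" "X * v1 < Y * (u1 - 1)"
    "u = X * w + k * (l * Y) * w'" "v = X * w' + l * Y * w"
    using least_associate[OF assms] by metis
  have neg: "X\<^sup>2 - k * Y\<^sup>2 < 0" using *(5) M(1) by simp
  have "real_of_int u + real_of_int v * sqrt (real_of_int k) =
       (real_of_int X + real_of_int l * real_of_int Y * sqrt (real_of_int k)) *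
       (real_of_int w + real_of_int w' * sqrt (real_of_int k))"
    using mult_sqrt_coeffs[of k X "l * Y" w w'] k unfolding *(8,9) by simp
  with conjugate_quotient_bounds[OF k *(1,2) neg pell *(7)] *(1-6) that show thesis
    by (simp add: coprime_iff_gcd_eq_1)
qed

section \<open>From the equation to an element of norm \<open>N ^ y\<close>, and the choice of
  \<open>Z1\<close>\<close>

theorem theorem1p3:
  fixes k x u1 v1 :: int and y z :: nat
  assumes "k > 1" and "\<not> is_square k"
    and "x > 0" and "z > 0" and "y \<in> {3, 5}"
    and "x^2 + (2 * k - 1)^y = k^z"
    and "least_pell_solution k u1 v1"
  shows "odd z \<and>
    (\<exists>(X1 :: int) (Y1 :: int) (Z1 :: nat) (t :: nat) (l :: int) (u :: int) (v :: int).
       X1 > 0 \<and> Y1 > 0 \<and> Z1 > 0 \<and> t > 0 \<and> l \<in> {1, -1} \<and> u^2 - k * v^2 = 1 \<and>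
       X1^2 - k * Y1^2 = (- (2 * k - 1))^Z1 \<and> gcd X1 Y1 = 1 \<and> Z1 dvd class_number (4 * k) \<and>
       1 < \<bar>(real_of_int X1 + real_of_int Y1 * sqrt (real_of_int k)) /
            (real_of_int X1 - real_of_int Y1 * sqrt (real_of_int k))\<bar> \<and>
       \<bar>(real_of_int X1 + real_of_int Y1 * sqrt (real_of_int k)) /
        (real_of_int X1 - real_of_int Y1 * sqrt (real_of_int k))\<bar>
         < real_of_int u1 + real_of_int v1 * sqrt (real_of_int k) \<and>
       y = Z1 * t \<and>
       real_of_int x + real_of_int k ^ ((z - 1) div 2) * sqrt (real_of_int k) =
         (real_of_int X1 + real_of_int l * real_of_int Y1 * sqrt (real_of_int k)) ^ t *
         (real_of_int u + real_of_int v * sqrt (real_of_int k)))"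
proof -
  have "odd z"
  proof
    assume "even z"
    then obtain m where "z = 2 * m" by blast
    then show False using assms(5,6) cubic_even_exponent[OF assms(1)] quintic_even_exponent[OF assms(1)] by auto
  qed
  then obtain m where z: "z = 2 * m + 1" by (rule oddE)
  then have m: "(z - 1) div 2 = m" by simp
  have y: "odd y" "y > 0" "prime y" using assms(5) by auto
  have pell: "u1 > 0" "v1 > 0" "u1\<^sup>2 - k * v1\<^sup>2 = 1"
    using assms(7) by (auto simp: least_pell_solution_def)
  define N where "N = - (2 * k - 1)"
  define K where "K = k ^ m"
  have N: "N < - 1" "N \<noteq> 0" "odd N" using assms(1) by (auto simp: N_def)
  have Nk: "coprime N k"
  proof (rule coprimeI)
    fix d assume "d dvd N" "d dvd k"
    then have "d dvd N + 2 * k" by simp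
    then show "is_unit d" by (simp add: N_def)
  qed
  have Ny: "N ^ y = - ((2 * k - 1) ^ y)" unfolding N_def using y(1) by (rule power_minus_odd)
  have "k ^ z = k * K\<^sup>2" unfolding z K_def by (simp add: power_mult mult.commute power_commutes flip: power_mult)
  then have norm: "x\<^sup>2 - k * K\<^sup>2 = N ^ y" unfolding Ny using assms(6) by simp
  have "(2 * k - 1) ^ y > 1" using assms(1) y(2) by (intro one_less_power) auto
  then have "N ^ y < - 1" unfolding Ny by simp
  then have M: "N ^ y < - 1" "odd (N ^ y)" "coprime (N ^ y) k" using N(3) Nk by simp_all
  have "coprime x k"
  proof (rule coprimeI)
    fix d assume d: "d dvd x" "d dvd k"
    then have "d dvd x\<^sup>2 - k * K\<^sup>2" by (simp add: power2_eq_square)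
    then show "is_unit d" using coprime_common_divisor[OF M(3), of d] d norm by simp
  qed
  then have xK: "coprime x K" by (simp add: K_def)
  have NK: "coprime (N ^ y) K" using M(3) by (simp add: K_def)
  then obtain i j where ij: "i * K + j * N ^ y = 1" using bezout_int[of K "N ^ y"] by (metis coprime_iff_gcd_eq_1 gcd.commute)
  \<comment> \<open>\<open>i\<close> inverts \<open>K\<close> modulo \<open>N ^ y\<close>, so
    \<open>\<beta>\<close> is the quotient of \<open>x\<close> by \<open>K\<close> there; the norm
    equation makes its square congruent to \<open>k\<close>.\<close>
  define \<beta> where "\<beta> = i * x"
  have "x - K * \<beta> = x * (1 - i * K)" unfolding \<beta>_def by (simp add: algebra_simps)
  also have "1 - i * K = j * N ^ y" using ij by simp
  finally have \<beta>1: "N ^ y dvd x - K * \<beta>" by simp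
  have "K\<^sup>2 * (\<beta>\<^sup>2 - k) = (x\<^sup>2 - k * K\<^sup>2) - (x - K * \<beta>) * (x + K * \<beta>)"
    by (simp add: algebra_simps power2_eq_square)
  then have "N ^ y dvd K\<^sup>2 * (\<beta>\<^sup>2 - k)" unfolding norm using \<beta>1 by (metis dvd_diff dvd_mult2 dvd_refl)
  moreover have "coprime (N ^ y) (K\<^sup>2)" using NK by simp
  ultimately have \<beta>2: "N ^ y dvd \<beta>\<^sup>2 - k" using coprime_dvd_mult_right_iff by blast
  have "\<exists>X1 Y1 Z1 t l u v.
       X1 > 0 \<and> Y1 > 0 \<and> Z1 > 0 \<and> t > 0 \<and> l \<in> {1, -1} \<and> u\<^sup>2 - k * v\<^sup>2 = 1 \<and>
       X1\<^sup>2 - k * Y1\<^sup>2 = N ^ Z1 \<and> gcd X1 Y1 = 1 \<and> Z1 dvd class_number (4 * k) \<and>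
       1 < \<bar>(real_of_int X1 + real_of_int Y1 * sqrt (real_of_int k)) /
            (real_of_int X1 - real_of_int Y1 * sqrt (real_of_int k))\<bar> \<and>
       \<bar>(real_of_int X1 + real_of_int Y1 * sqrt (real_of_int k)) /
        (real_of_int X1 - real_of_int Y1 * sqrt (real_of_int k))\<bar>
         < real_of_int u1 + real_of_int v1 * sqrt (real_of_int k) \<and>
       y = Z1 * t \<and>
       real_of_int x + real_of_int K * sqrt (real_of_int k) =
         (real_of_int X1 + real_of_int l * real_of_int Y1 * sqrt (real_of_int k)) ^ t *
         (real_of_int u + real_of_int v * sqrt (real_of_int k))"
    using norm_power_dichotomy[OF N(2,3) Nk y(3) norm \<beta>2 \<beta>1]
  proof (elim disjE exE conjE)
    \<comment> \<open>Here \<open>Z1 = y\<close> and \<open>t = 1\<close>: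
      \<open>x + K * sqrt k\<close> itself is normalised.\<close>
    assume dvd: "y dvd class_number (4 * k)"
    obtain X Y l w w' where XY: "X > 0" "Y > 0" "l \<in> {1, -1}" "w\<^sup>2 - k * w'\<^sup>2 = 1"
      "X\<^sup>2 - k * Y\<^sup>2 = N ^ y" "gcd X Y = 1"
      "1 < \<bar>(real_of_int X + real_of_int Y * sqrt (real_of_int k)) /
            (real_of_int X - real_of_int Y * sqrt (real_of_int k))\<bar>"
      "\<bar>(real_of_int X + real_of_int Y * sqrt (real_of_int k)) /
        (real_of_int X - real_of_int Y * sqrt (real_of_int k))\<bar>
         < real_of_int u1 + real_of_int v1 * sqrt (real_of_int k)"
      and e: "real_of_int x + real_of_int K * sqrt (real_of_int k) =
       (real_of_int X + real_of_int l * real_of_int Y * sqrt (real_of_int k)) *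
       (real_of_int w + real_of_int w' * sqrt (real_of_int k))"
      by (rule normalized_associate[OF assms(1) M norm xK pell])
    show ?thesis
      by (rule exI[of _ X], rule exI[of _ Y], rule exI[of _ y], rule exI[of _ 1],
          rule exI[of _ l], rule exI[of _ w], rule exI[of _ w'])
        (simp only: power_one_right mult_1_right XY dvd y(2) e; simp add: XY(3))
  next
    \<comment> \<open>Here \<open>Z1 = 1\<close> and \<open>t = y\<close>: the element of norm
      \<open>N\<close> is normalised, and the \<open>y\<close>-th power of the unit split off is
      merged with the unit from \<open>power_associate\<close>.\<close>
    fix u v assume uv: "u\<^sup>2 - k * v\<^sup>2 = N" "coprime u v" "N dvd u - v * \<beta>"
    obtain X Y l w w' where XY: "X > 0" "Y > 0" "l \<in> {1, -1}" "w\<^sup>2 - k * w'\<^sup>2 = 1"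
      "X\<^sup>2 - k * Y\<^sup>2 = N" "gcd X Y = 1"
      "1 < \<bar>(real_of_int X + real_of_int Y * sqrt (real_of_int k)) /
            (real_of_int X - real_of_int Y * sqrt (real_of_int k))\<bar>"
      "\<bar>(real_of_int X + real_of_int Y * sqrt (real_of_int k)) /
        (real_of_int X - real_of_int Y * sqrt (real_of_int k))\<bar>
         < real_of_int u1 + real_of_int v1 * sqrt (real_of_int k)"
      and e1: "real_of_int u + real_of_int v * sqrt (real_of_int k) =
       (real_of_int X + real_of_int l * real_of_int Y * sqrt (real_of_int k)) *
       (real_of_int w + real_of_int w' * sqrt (real_of_int k))"
      by (rule normalized_associate[OF assms(1) N(1,3) Nk uv(1,2) pell])
    have k0: "k \<ge> 0" using assms(1) by simp
    obtain r r' where r: "r\<^sup>2 - k * r'\<^sup>2 = 1" "real_of_int x + real_of_int K * sqrt (real_of_int k)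
      = (real_of_int u + real_of_int v * sqrt (real_of_int k)) ^ y * (real_of_int r + real_of_int r' * sqrt (real_of_int k))"
      by (rule power_associate[OF N(2) k0 norm \<beta>2 \<beta>1 uv(1,3)])
    obtain W W' where W: "W\<^sup>2 - k * W'\<^sup>2 = 1"
      "(real_of_int w + real_of_int w' * sqrt (real_of_int k)) ^ y = real_of_int W + real_of_int W' * sqrt (real_of_int k)"
      using pell_power[OF \<beta>2 k0, of w w' y] unfolding XY(4) by auto
    have "(W * r + k * W' * r')\<^sup>2 - k * (W * r' + W' * r)\<^sup>2 = (W\<^sup>2 - k * W'\<^sup>2) * (r\<^sup>2 - k * r'\<^sup>2)"
      by (simp add: algebra_simps power2_eq_square)
    then have unit: "(W * r + k * W' * r')\<^sup>2 - k * (W * r' + W' * r)\<^sup>2 = 1" unfolding W(1) r(1) by simp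
    have e: "real_of_int x + real_of_int K * sqrt (real_of_int k)
      = (real_of_int X + real_of_int l * real_of_int Y * sqrt (real_of_int k)) ^ y *
        (real_of_int (W * r + k * W' * r') + real_of_int (W * r' + W' * r) * sqrt (real_of_int k))"
      unfolding r(2) e1 power_mult_distrib W(2) mult.assoc mult_sqrt_coeffs[OF k0] ..
    show ?thesis
      by (rule exI[of _ X], rule exI[of _ Y], rule exI[of _ 1], rule exI[of _ y],
          rule exI[of _ l], rule exI[of _ "W * r + k * W' * r'"], rule exI[of _ "W * r' + W' * r"])
        (simp only: power_one_right mult_1_left XY(1-3,5-8) unit y(2) e; simp add: XY(3))
  qed
  with \<open>odd z\<close> show ?thesis unfolding m N_def K_def of_int_power by blast
qed

end
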